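(* Let $d=2$, let $N\ge2$ be an integer and let $p_c(N,2)\le p<1$. There exists a constant $\kappa>1$ such that, almost surely, all continuous curves in $\mathcal C^c$ have Hausdorff dimension at least $\kappa$, where $\mathcal C^c$ is the union of the connected components larger than one point of the limiting set $\mathcal C$ of fractal percolation in $[0,1]^2$ with parameters $N,p$.
   Context: Fractal percolation ($d=2$). For an integer $N\ge 2$, a level-$n$ square ($n\ge1$) is a square $\left[\frac{k_1-1}{N^n},\frac{k_1}{N^n}\right]\times\left[\frac{k_2-1}{N^n},\frac{k_2}{N^n}\right]$ with $1\le k_1,k_2\le N^n$. Under $\mathbb P_p$, each square of each level is independently given $\omega=1$ with probability $p$ and $\omega=0$ with probability $1-p$. $\mathcal C^n\subset[0,1]^2$ is the union of all level-$n$ squares $Q$ such that $\omega=1$ for $Q$ and for each of the squares of levels $1,\dots,n-1$ containing $Q$; the limiting set is $\mathcal C=\bigcap_{n\ge1}\mathcal C^n$. Critical value: $p_c(N,2)=\sup\{p:\mathcal C\text{ is }\mathbb P_p\text{-a.s. totally disconnected}\}$. For $x\in\mathcal C$ let $\mathcal C_x$ be the connected component of $x$ in $\mathcal C$; $\mathcal C^c=\{x\in\mathcal C:\mathcal C_x\neq\{x\}\}$. A continuous curve is an equivalence class of continuous functions $[0,1]\to[0,1]^2$ modulo strictly monotonic re-parametrizations; its Hausdorff dimension is that of its image.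
   Formalization: The dimension bound is stated for all nonconstant continuous curves in C^c; constant curves are excluded, since a constant curve at a point of C^c has Hausdorff dimension 0. *)

theory Defs
  imports "HOL-Probability.Probability"
begin

section \<open>Hausdorff dimension\<close>

text \<open>The convention is diam(U)^0 = 1 for nonempty U, and the empty set contributes 0.
  The case s = 0 is separate because 0 powr 0 = 0 in HOL.\<close>

definition diam_power :: "real \<Rightarrow> 'a::metric_space set \<Rightarrow> ennreal" where
  "diam_power s U =
     (if U = {} then 0 else if s = 0 then 1 else ennreal (diameter U powr s))"

text \<open>Boundedness is required because \<^const>\<open>diameter\<close> is unspecified on unbounded sets.
  Finite covers are included, by padding with empty sets.\<close>

definition hausdorff_content :: "real \<Rightarrow> real \<Rightarrow> 'a::metric_space set \<Rightarrow> ennreal" where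
  "hausdorff_content s \<delta> A =
     (INF U \<in> {U :: nat \<Rightarrow> 'a set. A \<subseteq> (\<Union>i. U i) \<and> (\<forall>i. bounded (U i) \<and> diameter (U i) \<le> \<delta>)}.
        (\<Sum>i. diam_power s (U i)))"

definition hausdorff_measure :: "real \<Rightarrow> 'a::metric_space set \<Rightarrow> ennreal" where
  "hausdorff_measure s A = (SUP \<delta> \<in> {0<..}. hausdorff_content s \<delta> A)"

definition hausdorff_dim :: "'a::metric_space set \<Rightarrow> ennreal" where
  "hausdorff_dim A = Inf {ennreal s | s. 0 \<le> s \<and> hausdorff_measure s A = 0}"


section \<open>Fractal percolation in the unit square\<close>

text \<open>The triple \<open>(n, k1, k2)\<close> stands for a level-\<open>n\<close> square.\<close>

type_synonym square = "nat \<times> nat \<times> nat"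

definition squares :: "nat \<Rightarrow> square set" where
  "squares N = {(n, k1, k2). 1 \<le> n \<and> k1 \<in> {1..N ^ n} \<and> k2 \<in> {1..N ^ n}}"

fun cell :: "nat \<Rightarrow> square \<Rightarrow> (real \<times> real) set" where
  "cell N (n, k1, k2) =
     {(real k1 - 1) / real (N ^ n) .. real k1 / real (N ^ n)} \<times>
     {(real k2 - 1) / real (N ^ n) .. real k2 / real (N ^ n)}"

definition perc_measure :: "nat \<Rightarrow> real \<Rightarrow> (square \<Rightarrow> bool) measure" where
  "perc_measure N p = (\<Pi>\<^sub>M Q \<in> squares N. measure_pmf (bernoulli_pmf p))"

definition perc_level :: "nat \<Rightarrow> (square \<Rightarrow> bool) \<Rightarrow> nat \<Rightarrow> (real \<times> real) set" where
  "perc_level N \<omega> n =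
     \<Union> {cell N Q | Q. Q \<in> squares N \<and> fst Q = n \<and> \<omega> Q \<and>
         (\<forall>Q' \<in> squares N. fst Q' < n \<and> cell N Q \<subseteq> cell N Q' \<longrightarrow> \<omega> Q')}"

definition perc_limit :: "nat \<Rightarrow> (square \<Rightarrow> bool) \<Rightarrow> (real \<times> real) set" where
  "perc_limit N \<omega> = (\<Inter>n \<in> {1..}. perc_level N \<omega> n)"

definition totally_disconnected :: "'a::topological_space set \<Rightarrow> bool" where
  "totally_disconnected S \<longleftrightarrow> (\<forall>x \<in> S. connected_component_set S x = {x})"

definition crit_prob :: "nat \<Rightarrow> real" where
  "crit_prob N =
     Sup {p \<in> {0..1}. AE \<omega> in perc_measure N p. totally_disconnected (perc_limit N \<omega>)}"

definition perc_connected :: "nat \<Rightarrow> (square \<Rightarrow> bool) \<Rightarrow> (real \<times> real) set" where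
  "perc_connected N \<omega> =
     {x \<in> perc_limit N \<omega>. connected_component_set (perc_limit N \<omega>) x \<noteq> {x}}"


section \<open>Curves modulo re-parametrization\<close>

text \<open>Functions on [0,1] are represented by total functions on the reals; taking
  \<open>\<phi>\<close> to be the identity shows that the values outside [0,1] are irrelevant.\<close>

definition param_curves :: "(real \<Rightarrow> real \<times> real) set" where
  "param_curves = {f. path f \<and> path_image f \<subseteq> {0..1} \<times> {0..1}}"

definition reparam_rel :: "((real \<Rightarrow> real \<times> real) \<times> (real \<Rightarrow> real \<times> real)) set" where
  "reparam_rel =
     {(f, g). f \<in> param_curves \<and> g \<in> param_curves \<and>
        (\<exists>\<phi>. bij_betw \<phi> {0..1} {0..1} \<and>
             (strict_mono_on {0..1} \<phi> \<or> strict_antimono_on {0..1} \<phi>) \<and>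
             (\<forall>t \<in> {0..1}. g t = f (\<phi> t)))}"

definition curves :: "(real \<Rightarrow> real \<times> real) set set" where
  "curves = param_curves // reparam_rel"

text \<open>All representatives of a curve have the same image, so the union is that image.\<close>

definition curve_image :: "(real \<Rightarrow> real \<times> real) set \<Rightarrow> (real \<times> real) set" where
  "curve_image \<Gamma> = (\<Union>f \<in> \<Gamma>. path_image f)"

text \<open>A constant curve has dimension 0, so lower bounds on the dimension of curves tacitly
  concern nonconstant ones.\<close>

definition nonconstant_curve :: "(real \<Rightarrow> real \<times> real) set \<Rightarrow> bool" where
  "nonconstant_curve \<Gamma> \<longleftrightarrow> (\<nexists>x. curve_image \<Gamma> = {x})"

end

theory Submission
  imports Defs
begin

text \<open>The proof is a renormalisation argument in the spirit of Aizenman and Burchard. Let \<open>g = N\<^sup>m\<close> be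
  large, \<open>M = g\<^sup>3\<close>, and consider cells of side \<open>M\<^sup>-\<^sup>n\<close>. A path in the limiting set that
  crosses a distance \<open>M\<^sup>-\<^sup>n\<close> almost in a straight line avoids all closed blocks along that line, which
  for a given starting cell has probability exponentially small in \<open>g\<close>. Any other path makes a detour by
  a factor \<open>1 + g\<^sup>-\<^sup>2\<close> and contains more than \<open>(1 + g\<^sup>-\<^sup>2 / 2) M\<close> well separated subpaths
  crossing a distance \<open>M\<^sup>-\<^sup>n\<^sup>-\<^sup>1\<close>. Call a cell bad if a straight path may start near it or if two
  distant cells of the next scale near it are bad. If \<open>\<rho>\<close> bounds the probability of the first
  alternative, then by independence the probability of being bad stays below \<open>2\<rho>\<close> as the number of
  scales grows. Below a cell that is not bad, all but boundedly many of the subpaths start again in cells that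
  are not bad, which gives a lower bound for the cost of all covers by induction over the scales, with an exponent
  larger than 1.\<close>

section \<open>Subdivision of paths\<close>

text \<open>The cube in \<open>M = g^3\<close> pays for the losses. A detour by the factor
  \<open>1 + 1 / g^2\<close> yields about \<open>M / g^2 = g\<close> additional subpaths, while only
  a bounded number is lost: one at the end, and those that start in bad cells. The latter are few
  because two distant bad cells are excluded, so that all bad starts lie in a window of fixed size.
  The price is polynomial in \<open>g\<close>: a cell has of order \<open>g^3\<close> candidate
  lines and \<open>g^12\<close> pairs of children, which the exponentially small probability of one
  open line outweighs.

  Independence is available for events determined by finitely many squares. Badness therefore
  inspects only \<open>j\<close> scales; it increases with \<open>j\<close>, and its probability
  bounds are uniform in \<open>j\<close>.

  Even so, a given path may start in a bad cell. It is followed down to a finer scale until a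
  subpath starts in a cell that is good for all \<open>j\<close>. The number of scales this takes
  depends on the path, and so does the resulting lower bound on the cost of covers; the exponent
  does not.\<close>

lemma first_hit:
  fixes f :: "real \<Rightarrow> real"
  assumes "s \<le> t" "continuous_on {s..t} f" "f s \<le> c" "c \<le> f t"
  shows "\<exists>\<tau>\<in>{s..t}. f \<tau> = c \<and> (\<forall>u\<in>{s..\<tau>}. f u \<le> c)"
proof -
  define S where "S = {u \<in> {s..t}. c \<le> f u}"
  have cl: "closed S"
    unfolding S_def using assms(2)
    by (intro continuous_on_closed_Collect_le) (auto intro: continuous_intros)
  have ne: "t \<in> S" using assms by (auto simp: S_def)
  have bb: "bdd_below S" by (rule bdd_belowI[of _ s]) (auto simp: S_def)
  define \<tau> where "\<tau> = Inf S"
  have tS: "\<tau> \<in> S" unfolding \<tau>_def using closed_contains_Inf[OF _ bb cl] ne by auto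
  have lt: "f u < c" if "u \<in> {s..<\<tau>}" for u
  proof (rule ccontr)
    assume "\<not> f u < c"
    then have "u \<in> S" using that tS by (auto simp: S_def)
    then have "\<tau> \<le> u" unfolding \<tau>_def by (intro cInf_lower bb)
    then show False using that by simp
  qed
  have "continuous_on {s..\<tau>} f" using assms(2) tS by (auto simp: S_def intro: continuous_on_subset)
  then obtain x where x: "s \<le> x" "x \<le> \<tau>" "f x = c"
    using IVT'[of f s c \<tau>] assms(3) tS by (auto simp: S_def)
  then have "x = \<tau>" using lt[of x] by force
  then show ?thesis using x tS lt by (intro bexI[of _ \<tau>]) (auto simp: S_def less_eq_real_def)
qed

lemma last_hit:
  fixes f :: "real \<Rightarrow> real"
  assumes "s \<le> t" "continuous_on {s..t} f" "f s \<le> c" "c \<le> f t"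
  shows "\<exists>\<sigma>\<in>{s..t}. f \<sigma> = c \<and> (\<forall>u\<in>{\<sigma>..t}. c \<le> f u)"
proof -
  have "continuous_on {- t.. - s} (\<lambda>u. - f (- u))"
    by (intro continuous_intros continuous_on_compose2[OF assms(2)]) auto
  then obtain \<tau> where t: "\<tau> \<in> {-t.. -s}" "- f (- \<tau>) = - c" "\<And>u. u \<in> {-t..\<tau>} \<Longrightarrow> - f (- u) \<le> - c"
    using first_hit[of "-t" "-s" "\<lambda>u. - f (- u)" "-c"] assms by auto
  have "c \<le> f u" if "u \<in> {-\<tau>..t}" for u
    using t(3)[of "- u"] that by auto
  then show ?thesis using t by (intro bexI[of _ "-\<tau>"]) auto
qed

text \<open>The recursion stops: by uniform continuity there is \<open>\<eta> > 0\<close> such that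
  getting out of the ball of radius \<open>r\<close> takes time at least \<open>\<eta>\<close>. The
  induction runs over a bound on the remaining time in units of \<open>\<eta>\<close>.\<close>

lemma separated_chain:
  fixes f :: "real \<Rightarrow> 'a::metric_space"
  assumes "s \<le> t" and cont: "continuous_on {s..t} f" and r: "r > 0"
  shows "\<exists>m \<sigma>. \<sigma> 0 = s \<and> (\<forall>i\<le>m. \<sigma> i \<in> {s..t}) \<and>
     (\<forall>i<m. \<sigma> i \<le> \<sigma> (Suc i) \<and> dist (f (\<sigma> (Suc i))) (f (\<sigma> i)) = r \<and>
        (\<forall>u\<in>{\<sigma> (Suc i)..t}. r \<le> dist (f u) (f (\<sigma> i)))) \<and>
     dist (f (\<sigma> m)) (f t) < r"
proof -
  have "uniformly_continuous_on {s..t} f" using cont by (intro compact_uniformly_continuous) auto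
  then obtain \<eta> where \<eta>: "\<eta> > 0"
    "\<And>x x'. x \<in> {s..t} \<Longrightarrow> x' \<in> {s..t} \<Longrightarrow> dist x' x < \<eta> \<Longrightarrow> dist (f x') (f x) < r"
    using r unfolding uniformly_continuous_on_def by metis
  have "\<exists>m \<sigma>. \<sigma> 0 = a \<and> (\<forall>i\<le>m. \<sigma> i \<in> {a..t}) \<and>
     (\<forall>i<m. \<sigma> i \<le> \<sigma> (Suc i) \<and> dist (f (\<sigma> (Suc i))) (f (\<sigma> i)) = r \<and>
        (\<forall>u\<in>{\<sigma> (Suc i)..t}. r \<le> dist (f u) (f (\<sigma> i)))) \<and>
     dist (f (\<sigma> m)) (f t) < r" if "a \<in> {s..t}" "t - a < real (Suc k) * \<eta>" for a k
    using that
  proof (induction k arbitrary: a)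
    case 0
    then show ?case
      using \<eta>(2)[of t a] by (intro exI[of _ 0] exI[of _ "\<lambda>_. a"]) (auto simp: dist_real_def)
  next
    case (Suc k)
    show ?case
    proof (cases "dist (f a) (f t) < r")
      case True
      then show ?thesis using Suc.prems by (intro exI[of _ 0] exI[of _ "\<lambda>_. a"]) auto
    next
      case False
      have "continuous_on {a..t} f" using cont Suc.prems by (auto intro: continuous_on_subset)
      then have "continuous_on {a..t} (\<lambda>u. dist (f u) (f a))" by (intro continuous_intros)
      then obtain b where b: "b \<in> {a..t}" "dist (f b) (f a) = r"
        "\<And>u. u \<in> {b..t} \<Longrightarrow> r \<le> dist (f u) (f a)"
        using last_hit[of a t "\<lambda>u. dist (f u) (f a)" r] Suc.prems False r
        by (auto simp: dist_commute not_less)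
      have "\<eta> \<le> b - a" using \<eta>(2)[of a b] b Suc.prems by (force simp: dist_real_def)
      then have "t - b < real (Suc k) * \<eta>" using Suc.prems by (simp add: algebra_simps)
      with Suc.IH[of b] b Suc.prems obtain m \<sigma> where \<sigma>: "\<sigma> 0 = b" "\<forall>i\<le>m. \<sigma> i \<in> {b..t}"
        "\<forall>i<m. \<sigma> i \<le> \<sigma> (Suc i) \<and> dist (f (\<sigma> (Suc i))) (f (\<sigma> i)) = r \<and>
          (\<forall>u\<in>{\<sigma> (Suc i)..t}. r \<le> dist (f u) (f (\<sigma> i)))"
        "dist (f (\<sigma> m)) (f t) < r" by auto
      define \<rho> where "\<rho> = case_nat a \<sigma>"
      have "\<rho> i \<le> \<rho> (Suc i) \<and> dist (f (\<rho> (Suc i))) (f (\<rho> i)) = r \<and>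
          (\<forall>u\<in>{\<rho> (Suc i)..t}. r \<le> dist (f u) (f (\<rho> i)))" if "i < Suc m" for i
        using that \<sigma> b by (cases i) (auto simp: \<rho>_def)
      moreover have "\<rho> i \<in> {a..t}" if "i \<le> Suc m" for i
        using that \<sigma>(2)[rule_format, of "i - 1"] b Suc.prems by (cases i) (auto simp: \<rho>_def)
      moreover have "\<rho> 0 = a" "dist (f (\<rho> (Suc m))) (f t) < r" using \<sigma> by (auto simp: \<rho>_def)
      ultimately show ?thesis by blast
    qed
  qed
  moreover obtain k where "t - s < real k * \<eta>" using reals_Archimedean3[OF \<eta>(1)] by blast
  then have "t - s < real (Suc k) * \<eta>" using \<eta>(1) by (simp add: algebra_simps)
  ultimately show ?thesis using assms(1) by auto
qed

text \<open>Starting the next piece at the last exit from the ball of radius \<open>r\<close> around the start of the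
  current one keeps all later pieces outside that ball, while a piece stays in the ball of radius \<open>l\<close>.\<close>

lemma separated_pieces:
  fixes f :: "real \<Rightarrow> 'a::metric_space"
  assumes st: "s \<le> t" and cont: "continuous_on {s..t} f" and l: "0 < l" "l < r"
  obtains m \<sigma> \<tau> where "\<sigma> 0 = s" and "\<And>i. i \<le> m \<Longrightarrow> \<sigma> i \<in> {s..t}"
    and "\<And>i. i < m \<Longrightarrow> \<sigma> i \<le> \<tau> i \<and> \<tau> i \<le> t \<and> dist (f (\<sigma> i)) (f (\<tau> i)) = l \<and>
        (\<forall>u\<in>{\<sigma> i..\<tau> i}. dist (f (\<sigma> i)) (f u) \<le> l)"
    and "\<And>i. i < m \<Longrightarrow> dist (f (\<sigma> i)) (f (\<sigma> (Suc i))) = r"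
    and "\<And>i i' u u'. i < i' \<Longrightarrow> i' < m \<Longrightarrow> u \<in> {\<sigma> i..\<tau> i} \<Longrightarrow> u' \<in> {\<sigma> i'..\<tau> i'} \<Longrightarrow>
        r - l \<le> dist (f u) (f u')"
    and "\<And>i i'. i < i' \<Longrightarrow> i' \<le> m \<Longrightarrow> r \<le> dist (f (\<sigma> i)) (f (\<sigma> i'))"
    and "dist (f (\<sigma> m)) (f t) < r"
proof -
  have "r > 0" using l by simp
  from separated_chain[OF st cont this] obtain m \<sigma> where \<sigma>: "\<sigma> 0 = s" "\<And>i. i \<le> m \<Longrightarrow> \<sigma> i \<in> {s..t}"
    "\<And>i. i < m \<Longrightarrow> \<sigma> i \<le> \<sigma> (Suc i)"
    "\<And>i. i < m \<Longrightarrow> dist (f (\<sigma> (Suc i))) (f (\<sigma> i)) = r"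
    "\<And>i u. i < m \<Longrightarrow> u\<in>{\<sigma> (Suc i)..t} \<Longrightarrow> r \<le> dist (f u) (f (\<sigma> i))"
    "dist (f (\<sigma> m)) (f t) < r" by force
  have mono: "\<sigma> i \<le> \<sigma> j" if "i \<le> j" "j \<le> m" for i j
    using that
  proof (induction j rule: dec_induct)
    case (step n)
    then show ?case using \<sigma>(3)[of n] by simp
  qed simp
  have "\<exists>\<tau>. \<sigma> i \<le> \<tau> \<and> \<tau> \<le> t \<and> dist (f (\<sigma> i)) (f \<tau>) = l \<and> (\<forall>u\<in>{\<sigma> i..\<tau>}. dist (f (\<sigma> i)) (f u) \<le> l)"
    if i: "i < m" for i
  proof -
    have in1: "\<sigma> i \<in> {s..t}" and in2: "\<sigma> (Suc i) \<in> {s..t}" using \<sigma>(2) i by auto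
    have "continuous_on {\<sigma> i..\<sigma> (Suc i)} f" using cont in1 in2 by (auto intro: continuous_on_subset)
    then have "continuous_on {\<sigma> i..\<sigma> (Suc i)} (\<lambda>u. dist (f (\<sigma> i)) (f u))" by (intro continuous_intros)
    from first_hit[OF \<sigma>(3)[OF i] this, of l] \<sigma>(4)[OF i] l in2 show ?thesis
      by (force simp: dist_commute)
  qed
  then obtain \<tau> where \<tau>: "\<And>i. i < m \<Longrightarrow> \<sigma> i \<le> \<tau> i \<and> \<tau> i \<le> t \<and> dist (f (\<sigma> i)) (f (\<tau> i)) = l \<and>
      (\<forall>u\<in>{\<sigma> i..\<tau> i}. dist (f (\<sigma> i)) (f u) \<le> l)" by metis
  have far: "r \<le> dist (f (\<sigma> i)) (f u)" if "i < i'" "i' \<le> m" "\<sigma> i' \<le> u" "u \<le> t" for i i' u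
    using \<sigma>(5)[of i u] mono[of "Suc i" i'] that by (auto simp: dist_commute)
  have sep: "r - l \<le> dist (f u) (f u')" if "i < i'" "i' < m" "u \<in> {\<sigma> i..\<tau> i}" "u' \<in> {\<sigma> i'..\<tau> i'}" for i i' u u'
  proof -
    have "r \<le> dist (f (\<sigma> i)) (f u')" using far[of i i' u'] \<tau>[of i'] that by auto
    also have "\<dots> \<le> dist (f (\<sigma> i)) (f u) + dist (f u) (f u')" by (rule dist_triangle)
    finally show ?thesis using \<tau>[of i] that by force
  qed
  have sep': "r \<le> dist (f (\<sigma> i)) (f (\<sigma> i'))" if "i < i'" "i' \<le> m" for i i'
    using far[OF that, of "\<sigma> i'"] \<sigma>(2)[of i'] that by auto
  show ?thesis
    by (rule that[OF \<sigma>(1,2) \<tau> \<sigma>(4)[unfolded dist_commute[of "f (\<sigma> (Suc _))"]] sep sep' \<sigma>(6)])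
qed

section \<open>Chains close to a segment\<close>

text \<open>Steps of size at most 1 cannot jump over an interval of length 1. Both orders of the
  ends occur, since a chain may run from right to left.\<close>

lemma discrete_ivt:
  fixes f :: "nat \<Rightarrow> real"
  assumes step: "\<And>i. i < k \<Longrightarrow> \<bar>f (Suc i) - f i\<bar> \<le> 1"
    and "f 0 \<le> X \<and> X + 1 \<le> f k \<or> f k \<le> X \<and> X + 1 \<le> f 0"
  shows "\<exists>i\<le>k. X \<le> f i \<and> f i \<le> X + 1"
proof (rule ccontr)
  assume no: "\<not> ?thesis"
  from assms(2) show False
  proof
    assume ends: "f 0 \<le> X \<and> X + 1 \<le> f k"
    have "f i < X" if "i \<le> k" for i
      using that
    proof (induction i)
      case 0
      then show ?case using no ends by force
    next
      case (Suc i)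
      then show ?case using no step[of i] by (smt (verit) Suc_leD Suc_le_lessD)
    qed
    from this[of k] ends show False by simp
  next
    assume ends: "f k \<le> X \<and> X + 1 \<le> f 0"
    have "X + 1 < f i" if "i \<le> k" for i
      using that
    proof (induction i)
      case 0
      then show ?case using no ends by force
    next
      case (Suc i)
      then show ?case using no step[of i] by (smt (verit) Suc_leD Suc_le_lessD)
    qed
    from this[of k] ends show False by simp
  qed
qed

text \<open>By Heron's formula, a point of the ellipse with foci \<open>x\<close> and \<open>y\<close> and such a small
  excess lies within distance 1 of the line through the foci.\<close>

lemma ellipse_cross_product:
  fixes x y u :: "real \<times> real"
  defines "d \<equiv> dist x y"
  assumes d: "d \<ge> 1" and ell: "dist x u + dist u y < (1 + 1 / d\<^sup>2) * d"
  shows "((fst u - fst x) * (snd y - snd x) - (snd u - snd x) * (fst y - fst x))\<^sup>2 \<le> d\<^sup>2"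
proof -
  define p where "p = dist x u"
  define q where "q = dist u y"
  have p2: "p\<^sup>2 = (fst u - fst x)\<^sup>2 + (snd u - snd x)\<^sup>2"
    by (simp add: p_def dist_prod_def dist_real_def power2_commute)
  have q2: "q\<^sup>2 = (fst u - fst y)\<^sup>2 + (snd u - snd y)\<^sup>2"
    by (simp add: q_def dist_prod_def dist_real_def power2_commute)
  have d2: "d\<^sup>2 = (fst x - fst y)\<^sup>2 + (snd x - snd y)\<^sup>2"
    by (simp add: d_def dist_prod_def dist_real_def power2_commute)
  have "4 * ((fst u - fst x) * (snd y - snd x) - (snd u - snd x) * (fst y - fst x))\<^sup>2 =
    4 * p\<^sup>2 * d\<^sup>2 - (p\<^sup>2 + d\<^sup>2 - q\<^sup>2)\<^sup>2"
    unfolding p2 q2 d2 by algebra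
  also have "\<dots> = ((p + q)\<^sup>2 - d\<^sup>2) * (d\<^sup>2 - (p - q)\<^sup>2)" by algebra
  also have "\<dots> \<le> 4 * d\<^sup>2"
  proof (rule mult_mono)
    have "p + q \<le> (1 + 1 / d\<^sup>2) * d" "0 \<le> p + q" using ell by (auto simp: p_def q_def)
    then have "(p + q)\<^sup>2 \<le> ((1 + 1 / d\<^sup>2) * d)\<^sup>2" by (intro power_mono)
    also have "\<dots> = d\<^sup>2 + 2 + 1 / d\<^sup>2" using d by (simp add: field_simps power2_eq_square)
    finally have "(p + q)\<^sup>2 \<le> d\<^sup>2 + 2 + 1 / d\<^sup>2" .
    moreover have "1 / d\<^sup>2 \<le> 1" using one_le_power[OF d, of 2] by (simp add: divide_le_eq)
    ultimately show "(p + q)\<^sup>2 - d\<^sup>2 \<le> 4" by simp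
    have "\<bar>p - q\<bar> \<le> \<bar>d\<bar>"
      using dist_triangle[of x u y] dist_triangle[of u y x] d
      by (auto simp: p_def q_def d_def dist_commute abs_le_iff)
    then show "0 \<le> d\<^sup>2 - (p - q)\<^sup>2" by (simp add: abs_le_square_iff)
  qed auto
  finally show ?thesis by simp
qed

text \<open>Cells are measured in units of the fine grid. A line is discretised by the integers \<open>X\<close>
  (first column), \<open>A\<close> (height there) and \<open>S\<close> (\<open>g\<close> times the slope), so that only polynomially many
  lines in \<open>g\<close> have to be considered; it is open if none of about \<open>g / 20\<close> disjoint
  \<open>13 \<times> 13\<close> blocks along it is completely closed.\<close>

definition line_open :: "nat \<Rightarrow> (int \<Rightarrow> int \<Rightarrow> bool) \<Rightarrow> int \<Rightarrow> int \<Rightarrow> int \<Rightarrow> bool" where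
  "line_open g P X A S \<longleftrightarrow> (\<forall>i\<in>{1..g div 20}. \<exists>u v. P u v \<and>
     \<bar>u - (X + 13 * int i)\<bar> \<le> 6 \<and> \<bar>v - (A + (S * (13 * int i)) div int g)\<bar> \<le> 6)"

text \<open>The chain meets every unit column between its ends, and there the thin ellipse keeps it
  at bounded vertical distance from the segment. Hence the open cell met in column
  \<open>X + 13 * i\<close> lies in the \<open>i\<close>-th block. Slope at most 1, from
  \<open>dom\<close>, bounds the vertical errors and makes the horizontal extent at least
  \<open>g / sqrt 2\<close>. The ranges of \<open>X\<close> and \<open>A\<close> reflect that the
  chain starts in the square \<open>(a, b)\<close> of side \<open>g\<close> and ends at distance
  \<open>g\<close>.\<close>

lemma straight_chain_line_open:
  fixes z :: "nat \<Rightarrow> real \<times> real" and P :: "int \<Rightarrow> int \<Rightarrow> bool"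
  assumes g: "g \<ge> 40"
    and cells: "\<And>i. i \<le> k \<Longrightarrow> \<exists>u v. P u v \<and> u \<le> fst (z i) \<and> fst (z i) \<le> u + 1 \<and>
        v \<le> snd (z i) \<and> snd (z i) \<le> v + 1"
    and step: "\<And>i. i < k \<Longrightarrow> dist (z i) (z (Suc i)) \<le> 1"
    and d: "dist (z 0) (z k) = real g"
    and ell: "\<And>i. i \<le> k \<Longrightarrow> dist (z 0) (z i) + dist (z i) (z k) < (1 + 1 / (real g)\<^sup>2) * real g"
    and dom: "\<bar>snd (z k) - snd (z 0)\<bar> \<le> \<bar>fst (z k) - fst (z 0)\<bar>"
    and box: "of_int a * real g \<le> fst (z 0)" "fst (z 0) < (of_int a + 1) * real g"
      "of_int b * real g \<le> snd (z 0)" "snd (z 0) < (of_int b + 1) * real g"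
  shows "\<exists>X\<in>{(a - 1) * int g..(a + 1) * int g + 1}. \<exists>A\<in>{(b - 1) * int g..(b + 2) * int g}.
      \<exists>S\<in>{- int g..int g}. line_open g P X A S"
proof -
  define x1 where "x1 = fst (z 0)"
  define x2 where "x2 = snd (z 0)"
  define y1 where "y1 = fst (z k)"
  define y2 where "y2 = snd (z k)"
  define D where "D = y1 - x1"
  define \<beta> where "\<beta> = (y2 - x2) / D"
  define lo where "lo = min x1 y1"
  define X where "X = \<lfloor>lo\<rfloor> + 1"
  define \<alpha> where "\<alpha> = x2 + \<beta> * (of_int X - x1)"
  define A where "A = \<lfloor>\<alpha>\<rfloor>"
  define S where "S = \<lfloor>\<beta> * real g\<rfloor>"
  have g0: "real g \<ge> 40" using g by simp
  have d2: "(real g)\<^sup>2 = D\<^sup>2 + (y2 - x2)\<^sup>2"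
    using d by (simp add: dist_prod_def dist_real_def x1_def x2_def y1_def y2_def D_def power2_commute)
      (metis add_nonneg_nonneg real_sqrt_pow2 zero_le_power2)
  have "(y2 - x2)\<^sup>2 \<le> D\<^sup>2" using dom by (simp add: abs_le_square_iff x1_def x2_def y1_def y2_def D_def)
  then have D2: "(real g)\<^sup>2 \<le> 2 * D\<^sup>2" using d2 by simp
  have Dge: "0.7 * real g \<le> \<bar>D\<bar>"
  proof (rule power2_le_imp_le)
    have "(0.7 * real g)\<^sup>2 = 0.49 * (real g)\<^sup>2" by (simp add: power2_eq_square)
    also have "\<dots> \<le> 0.98 * D\<^sup>2" using D2 by simp
    also have "\<dots> \<le> \<bar>D\<bar>\<^sup>2" by simp
    finally show "(0.7 * real g)\<^sup>2 \<le> \<bar>D\<bar>\<^sup>2" .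
  qed simp
  have Dle: "\<bar>D\<bar> \<le> real g"
    by (rule power2_le_imp_le) (use d2 in auto)
  have D0: "D \<noteq> 0" using Dge g0 by auto
  have \<beta>1: "\<bar>\<beta>\<bar> \<le> 1"
    using dom D0 by (simp add: \<beta>_def D_def x1_def x2_def y1_def y2_def)
  have lohi: "lo + 0.7 * real g \<le> max x1 y1" using Dge by (auto simp: lo_def D_def min_def max_def abs_if split: if_splits)
  have lo_x: "lo \<le> x1" "x1 - real g \<le> lo" using Dle by (auto simp: lo_def D_def)
  have Xlo: "lo < of_int X" "of_int X \<le> lo + 1" by (auto simp: X_def)
  have A: "of_int A \<le> \<alpha>" "\<alpha> < of_int A + 1" by (auto simp: A_def)
  have S: "of_int S \<le> \<beta> * real g" "\<beta> * real g < of_int S + 1" by (auto simp: S_def)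
  have \<beta>g: "\<bar>\<beta> * t\<bar> \<le> \<bar>t\<bar>" for t using \<beta>1 by (simp add: abs_mult mult_left_le_one_le)
  have "real_of_int ((a - 1) * int g) \<le> lo" using box lo_x by (simp add: x1_def algebra_simps)
  then have "(a - 1) * int g \<le> X" using Xlo by linarith
  moreover have "real_of_int X \<le> of_int ((a + 1) * int g + 1)"
    using box lo_x Xlo by (simp add: x1_def algebra_simps)
  then have "X \<le> (a + 1) * int g + 1" by linarith
  moreover have "\<bar>of_int X - x1\<bar> \<le> real g" using lo_x Xlo g0 by (simp add: abs_le_iff)
  then have \<alpha>x: "\<bar>\<alpha> - x2\<bar> \<le> real g"
    using \<beta>g[of "of_int X - x1"] by (simp add: \<alpha>_def)
  have "real_of_int ((b - 1) * int g) \<le> \<alpha>" using box \<alpha>x by (simp add: x2_def algebra_simps abs_if split: if_splits)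
  then have "(b - 1) * int g \<le> A" by (simp add: A_def le_floor_iff)
  moreover have "\<alpha> \<le> real_of_int ((b + 2) * int g)" using box \<alpha>x by (simp add: x2_def algebra_simps abs_if split: if_splits)
  then have "A \<le> (b + 2) * int g" using A by linarith
  moreover have "\<bar>S\<bar> \<le> int g" using \<beta>g[of "real g"] S by (simp add: abs_le_iff)
  moreover have "line_open g P X A S"
    unfolding line_open_def
  proof
    fix i assume i: "i \<in> {1..g div 20}"
    define w where "w = real (13 * i)"
    have "20 * i \<le> g" using i by auto
    then have "20 * real i \<le> real g" by linarith
    then have w: "0 \<le> w" "w \<le> 0.65 * real g" by (auto simp: w_def)
    define C where "C = real_of_int X + w"
    \<comment> \<open>The blocks use \<open>0.65 g\<close> of a horizontal extent of at least
      \<open>0.7 g\<close>. The rounding of \<open>X\<close> and the width of the column take up 2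
      more, and \<open>0.05 g \<ge> 2\<close> because \<open>g \<ge> 40\<close>.\<close>
    have ends: "x1 \<le> C \<and> C + 1 \<le> y1 \<or> y1 \<le> C \<and> C + 1 \<le> x1"
      using lohi Xlo w g0 by (auto simp: lo_def C_def min_def max_def split: if_splits)
    have "\<exists>j\<le>k. C \<le> fst (z j) \<and> fst (z j) \<le> C + 1"
    proof (rule discrete_ivt)
      fix i assume "i < k"
      then have "dist (fst (z (Suc i))) (fst (z i)) \<le> 1"
        using step[of i] dist_fst_le[of "z (Suc i)" "z i"] by (simp add: dist_commute)
      then show "\<bar>fst (z (Suc i)) - fst (z i)\<bar> \<le> 1" by (simp add: dist_real_def)
    qed (use ends in \<open>auto simp: x1_def y1_def\<close>)
    then obtain j where j: "j \<le> k" "C \<le> fst (z j)" "fst (z j) \<le> C + 1" by auto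
    define u1 where "u1 = fst (z j)"
    define u2 where "u2 = snd (z j)"
    have "((u1 - x1) * (y2 - x2) - (u2 - x2) * D)\<^sup>2 \<le> (real g)\<^sup>2"
      using ellipse_cross_product[of "z 0" "z k" "z j"] ell[OF j(1)] g0
      by (simp add: d u1_def u2_def x1_def x2_def y1_def y2_def D_def)
    also have "\<dots> \<le> 2 * D\<^sup>2" by (rule D2)
    finally have "((u1 - x1) * (y2 - x2) - (u2 - x2) * D)\<^sup>2 / D\<^sup>2 \<le> 2" using D0 by (simp add: divide_le_eq)
    moreover have "((u1 - x1) * (y2 - x2) - (u2 - x2) * D)\<^sup>2 / D\<^sup>2 = (u2 - x2 - \<beta> * (u1 - x1))\<^sup>2"
      using D0 unfolding \<beta>_def by (simp add: field_simps power2_eq_square)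
    ultimately have "(u2 - x2 - \<beta> * (u1 - x1))\<^sup>2 \<le> (1.5)\<^sup>2" by (simp add: power2_eq_square)
    then have dev: "\<bar>u2 - x2 - \<beta> * (u1 - x1)\<bar> \<le> 1.5" by (subst (asm) abs_le_square_iff[symmetric]) simp
    have "u2 - x2 - \<beta> * (u1 - x1) = u2 - \<alpha> - \<beta> * w - \<beta> * (u1 - C)"
      by (simp add: \<alpha>_def C_def algebra_simps)
    then have dev2: "\<bar>u2 - \<alpha> - \<beta> * w\<bar> \<le> 2.5"
      using dev \<beta>g[of "u1 - C"] j(2,3) unfolding u1_def[symmetric] by linarith
    define V where "V = (S * (13 * int i)) div int g"
    have V: "of_int V \<le> of_int S * w / real g" "of_int S * w / real g < of_int V + 1"
    proof -
      have *: "V = \<lfloor>of_int S * w / real g\<rfloor>"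
        unfolding V_def w_def using floor_divide_of_int_eq[of "S * (13 * int i)" "int g", where ?'a = real]
        by simp
      show "of_int V \<le> of_int S * w / real g" "of_int S * w / real g < of_int V + 1"
        unfolding * by linarith+
    qed
    have "of_int S * w \<le> \<beta> * real g * w" using S w by (intro mult_right_mono) auto
    then have V1: "of_int S * w / real g \<le> \<beta> * w" using g0 by (simp add: field_simps)
    have "\<beta> * real g * w \<le> (of_int S + 1) * w" using S w by (intro mult_right_mono) auto
    then have "\<beta> * w \<le> of_int S * w / real g + w / real g" using g0 by (simp add: field_simps)
    moreover have "w / real g \<le> 1" using w g0 by (simp add: divide_le_eq)
    ultimately have V2: "\<beta> * w \<le> of_int S * w / real g + 1" by simp
    \<comment> \<open>Error budget: 1.5 from the ellipse, 1 from the position inside the column, and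
      three downward roundings, in \<open>A\<close>, \<open>S\<close> and \<open>V\<close>, of
      effect at most 1 each. The corner of the cell lies at most 1 lower, and the total stays within
      6.\<close>
    have u2: "u2 - of_int (A + V) < 5.5" "- 2.5 \<le> u2 - of_int (A + V)"
      using dev2 V V1 V2 A unfolding of_int_add by linarith+
    obtain c e where ce: "P c e" "c \<le> u1" "u1 \<le> c + 1" "e \<le> u2" "u2 \<le> e + 1"
      using cells[OF j(1)] by (auto simp: u1_def u2_def)
    have "\<bar>c - (X + 13 * int i)\<bar> \<le> 6"
      using ce j(2,3) unfolding u1_def[symmetric] C_def w_def by linarith
    moreover have "\<bar>e - (A + V)\<bar> \<le> 6" using ce u2 by linarith
    ultimately show "\<exists>u v. P u v \<and> \<bar>u - (X + 13 * int i)\<bar> \<le> 6 \<and>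
        \<bar>v - (A + (S * (13 * int i)) div int g)\<bar> \<le> 6"
      using ce(1) unfolding V_def by blast
  qed
  ultimately show ?thesis
    by (intro bexI[of _ X] bexI[of _ A] bexI[of _ S]) (auto simp: abs_le_iff)
qed

section \<open>Finitely determined events\<close>

text \<open>Squares are indexed by integers from 0 here, and by positive naturals in \<^const>\<open>squares\<close>;
  squares outside the unit square count as closed.\<close>

definition opn :: "nat \<Rightarrow> (square \<Rightarrow> bool) \<Rightarrow> nat \<Rightarrow> int \<Rightarrow> int \<Rightarrow> bool" where
  "opn N \<omega> L u v \<longleftrightarrow> 1 \<le> L \<and> 0 \<le> u \<and> u < int (N ^ L) \<and> 0 \<le> v \<and> v < int (N ^ L) \<and>
     \<omega> (L, nat (u + 1), nat (v + 1))"

text \<open>Phrased through \<open>opn\<close> instead of \<open>\<omega>\<close>, so that index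
  sets may stick out of the unit square, where \<open>opn\<close> is constantly false; cells near
  the boundary then need no separate treatment.\<close>

definition depends_on :: "nat \<Rightarrow> (nat \<times> int \<times> int) set \<Rightarrow> ((square \<Rightarrow> bool) \<Rightarrow> bool) \<Rightarrow> bool" where
  "depends_on N J P \<longleftrightarrow>
     (\<forall>\<omega> \<omega>'. (\<forall>(L, u, v)\<in>J. opn N \<omega> L u v = opn N \<omega>' L u v) \<longrightarrow> P \<omega> = P \<omega>')"

definition square_set :: "nat \<Rightarrow> (nat \<times> int \<times> int) set \<Rightarrow> square set" where
  "square_set N J = {(L, nat (u + 1), nat (v + 1)) | L u v. (L, u, v) \<in> J \<and>
     1 \<le> L \<and> 0 \<le> u \<and> u < int (N ^ L) \<and> 0 \<le> v \<and> v < int (N ^ L)}"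

lemma square_set_subset: "square_set N J \<subseteq> squares N"
  by (auto simp: square_set_def squares_def nat_le_iff)

lemma square_set_image:
  "square_set N J \<subseteq> (\<lambda>(L, u, v). (L, nat (u + 1), nat (v + 1))) ` J"
  by (force simp: square_set_def)

lemma finite_square_set: "finite J \<Longrightarrow> finite (square_set N J)"
  using finite_subset[OF square_set_image] by blast

lemma card_square_set: "finite J \<Longrightarrow> card (square_set N J) \<le> card J"
  using surj_card_le[OF _ square_set_image] by blast

lemma square_set_disjoint: "J \<inter> K = {} \<Longrightarrow> square_set N J \<inter> square_set N K = {}"
  by (auto simp: square_set_def nat_eq_iff2)

lemma opn_cong:
  assumes "\<And>q. q \<in> square_set N J \<Longrightarrow> \<omega> q = \<omega>' q" "(L, u, v) \<in> J"
  shows "opn N \<omega> L u v = opn N \<omega>' L u v"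
proof (cases "1 \<le> L \<and> 0 \<le> u \<and> u < int (N ^ L) \<and> 0 \<le> v \<and> v < int (N ^ L)")
  case True
  then have "(L, nat (u + 1), nat (v + 1)) \<in> square_set N J"
    using assms(2) unfolding square_set_def by blast
  then show ?thesis using assms(1) by (simp add: opn_def)
qed (auto simp: opn_def)

lemma depends_on_cong:
  assumes "depends_on N J P" "\<And>q. q \<in> square_set N J \<Longrightarrow> \<omega> q = \<omega>' q"
  shows "P \<omega> = P \<omega>'"
proof -
  have "\<forall>(L, u, v)\<in>J. opn N \<omega> L u v = opn N \<omega>' L u v" using opn_cong[OF assms(2)] by auto
  then show ?thesis using assms(1) unfolding depends_on_def by simp
qed

lemma depends_onD:
  "depends_on N J P \<Longrightarrow> \<forall>(L, u, v)\<in>J. opn N \<omega> L u v = opn N \<omega>' L u v \<Longrightarrow> P \<omega> = P \<omega>'"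
  unfolding depends_on_def by simp

lemma depends_on_mono: "depends_on N J P \<Longrightarrow> J \<subseteq> K \<Longrightarrow> depends_on N K P"
  unfolding depends_on_def by blast

lemma depends_on_opn: "(L, u, v) \<in> J \<Longrightarrow> depends_on N J (\<lambda>\<omega>. opn N \<omega> L u v)"
  unfolding depends_on_def by blast

lemma depends_on_const: "depends_on N J (\<lambda>\<omega>. c)"
  unfolding depends_on_def by blast

lemma depends_on_conj:
  "depends_on N J P \<Longrightarrow> depends_on N J Q \<Longrightarrow> depends_on N J (\<lambda>\<omega>. P \<omega> \<and> Q \<omega>)"
  unfolding depends_on_def by blast

lemma depends_on_disj:
  "depends_on N J P \<Longrightarrow> depends_on N J Q \<Longrightarrow> depends_on N J (\<lambda>\<omega>. P \<omega> \<or> Q \<omega>)"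
  unfolding depends_on_def by blast

lemma depends_on_ball:
  assumes "\<And>x. x \<in> I \<Longrightarrow> depends_on N J (P x)"
  shows "depends_on N J (\<lambda>\<omega>. \<forall>x\<in>I. P x \<omega>)"
  unfolding depends_on_def
  by (intro allI impI ball_cong refl depends_onD[OF assms])

lemma depends_on_bex:
  assumes "\<And>x. x \<in> I \<Longrightarrow> depends_on N J (P x)"
  shows "depends_on N J (\<lambda>\<omega>. \<exists>x\<in>I. P x \<omega>)"
  unfolding depends_on_def
  by (intro allI impI bex_cong refl depends_onD[OF assms])

section \<open>Measurability and independence of finitely determined events\<close>

lemma prob_space_perc_measure: "prob_space (perc_measure N p)"
  unfolding perc_measure_def by (intro prob_space_PiM measure_pmf.prob_space_axioms)

lemma space_perc_measure: "space (perc_measure N p) = (squares N \<rightarrow>\<^sub>E UNIV)"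
  by (simp add: perc_measure_def space_PiM)

lemma sets_PiM_measure_pmf_finite:
  assumes "finite A"
  shows "sets (PiM A (\<lambda>_. measure_pmf (q :: bool pmf))) = Pow (A \<rightarrow>\<^sub>E UNIV)"
proof -
  have "sets (PiM A (\<lambda>_. measure_pmf q)) = sets (PiM A (\<lambda>_. count_space (UNIV :: bool set)))"
    by (rule sets_PiM_cong) auto
  then show ?thesis using assms by (simp add: count_space_PiM_finite)
qed

lemma squares_nonempty: "N \<ge> 1 \<Longrightarrow> squares N \<noteq> {}"
  by (auto simp: squares_def intro!: exI[of _ "1::nat"])

text \<open>Independence is equivalent to the joint law being the product of the marginal laws, and
  the joint law is a product measure by construction.\<close>

lemma indep_vars_perc:
  assumes "N \<ge> 1"
  shows "prob_space.indep_vars (perc_measure N p) (\<lambda>_. measure_pmf (bernoulli_pmf p)) (\<lambda>i \<omega>. \<omega> i) (squares N)"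
proof -
  interpret prob_space "perc_measure N p" by (rule prob_space_perc_measure)
  have m: "(\<lambda>\<omega>. \<omega> i) \<in> measurable (perc_measure N p) (measure_pmf (bernoulli_pmf p))" if "i \<in> squares N" for i
    using that unfolding perc_measure_def by measurable
  have "distr (perc_measure N p) (\<Pi>\<^sub>M i\<in>squares N. measure_pmf (bernoulli_pmf p)) (\<lambda>x. \<lambda>i\<in>squares N. x i)
    = distr (perc_measure N p) (perc_measure N p) (\<lambda>x. x)"
    by (rule distr_cong) (auto simp: perc_measure_def space_PiM)
  also have "\<dots> = perc_measure N p" by (rule distr_id)
  also have "\<dots> = (\<Pi>\<^sub>M i\<in>squares N. distr (perc_measure N p) (measure_pmf (bernoulli_pmf p)) (\<lambda>\<omega>. \<omega> i))"
    unfolding perc_measure_def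
    by (intro PiM_cong refl sym[OF distr_PiM_component] measure_pmf.prob_space_axioms)
  finally show ?thesis
    using m by (subst indep_vars_iff_distr_eq_PiM'[OF squares_nonempty[OF assms]]) auto
qed

abbreviation prb :: "nat \<Rightarrow> real \<Rightarrow> ((square \<Rightarrow> bool) \<Rightarrow> bool) \<Rightarrow> real" where
  "prb N p P \<equiv> measure (perc_measure N p) {\<omega> \<in> space (perc_measure N p). P \<omega>}"

text \<open>The event is pulled back from a finite product of discrete spaces, where every set is
  measurable; measurability and independence are inherited from there. On the right \<open>P\<close>
  is applied to functions that are \<open>undefined\<close> off \<open>square_set N J\<close>, which
  is harmless by \<open>depends_on\<close>.\<close>

lemma depends_on_vimage:
  assumes "depends_on N J P"
  shows "{\<omega> \<in> space (perc_measure N p). P \<omega>} =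
    (\<lambda>\<omega>. restrict \<omega> (square_set N J)) -` {\<xi> \<in> square_set N J \<rightarrow>\<^sub>E UNIV. P \<xi>} \<inter> space (perc_measure N p)"
  using depends_on_cong[OF assms, of "restrict \<omega> (square_set N J)" \<omega> for \<omega>] by auto

lemma depends_on_sets:
  assumes "depends_on N J P" "finite J"
  shows "{\<omega> \<in> space (perc_measure N p). P \<omega>} \<in> sets (perc_measure N p)"
  unfolding depends_on_vimage[OF assms(1)]
proof (rule measurable_sets)
  show "(\<lambda>\<omega>. restrict \<omega> (square_set N J)) \<in> measurable (perc_measure N p)
     (PiM (square_set N J) (\<lambda>_. measure_pmf (bernoulli_pmf p)))"
    unfolding perc_measure_def by (intro measurable_restrict_subset square_set_subset)
  show "{\<xi> \<in> square_set N J \<rightarrow>\<^sub>E UNIV. P \<xi>} \<in> sets (PiM (square_set N J) (\<lambda>_. measure_pmf (bernoulli_pmf p)))"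
    using assms(2) by (auto simp: sets_PiM_measure_pmf_finite finite_square_set)
qed

lemma prob_conj_depends_on:
  assumes N: "N \<ge> 1" and P: "depends_on N J P" "finite J" and Q: "depends_on N K Q" "finite K"
    and JK: "J \<inter> K = {}"
  shows "prb N p (\<lambda>\<omega>. P \<omega> \<and> Q \<omega>) = prb N p P * prb N p Q"
proof -
  interpret prob_space "perc_measure N p" by (rule prob_space_perc_measure)
  let ?B = "\<lambda>_. measure_pmf (bernoulli_pmf p)"
  let ?J = "square_set N J" and ?K = "square_set N K"
  have ind: "indep_var (PiM ?J ?B) (\<lambda>\<omega>. restrict (\<lambda>i. \<omega> i) ?J) (PiM ?K ?B) (\<lambda>\<omega>. restrict (\<lambda>i. \<omega> i) ?K)"
    by (rule indep_var_restrict[OF indep_vars_perc[OF N]])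
      (use JK square_set_subset square_set_disjoint in auto)
  let ?X = "{\<xi> \<in> ?J \<rightarrow>\<^sub>E UNIV. P \<xi>}" and ?Y = "{\<xi> \<in> ?K \<rightarrow>\<^sub>E UNIV. Q \<xi>}"
  have "prob ((\<lambda>\<omega>. (restrict \<omega> ?J, restrict \<omega> ?K)) -` (?X \<times> ?Y) \<inter> space (perc_measure N p)) =
    prob ((\<lambda>\<omega>. restrict \<omega> ?J) -` ?X \<inter> space (perc_measure N p)) *
    prob ((\<lambda>\<omega>. restrict \<omega> ?K) -` ?Y \<inter> space (perc_measure N p))"
    using P(2) Q(2) by (intro indep_varD[OF ind]) (auto simp: sets_PiM_measure_pmf_finite finite_square_set)
  moreover have "(\<lambda>\<omega>. (restrict \<omega> ?J, restrict \<omega> ?K)) -` (?X \<times> ?Y) \<inter> space (perc_measure N p) =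
     {\<omega> \<in> space (perc_measure N p). P \<omega> \<and> Q \<omega>}"
    using depends_on_vimage[OF P(1), of p] depends_on_vimage[OF Q(1), of p] by blast
  ultimately show ?thesis unfolding depends_on_vimage[OF P(1), of p] depends_on_vimage[OF Q(1), of p] by simp
qed

text \<open>An inequality, since indices outside the unit square are closed with certainty and only
  those inside contribute a factor \<open>1 - q\<close>.\<close>

lemma prob_all_closed:
  assumes "N \<ge> 1" "finite J" "p \<le> 1" and q: "q = max 0 p"
  shows "(1 - q) ^ card J \<le> prb N p (\<lambda>\<omega>. \<forall>(L, u, v)\<in>J. \<not> opn N \<omega> L u v)"
proof -
  interpret product_prob_space "\<lambda>_. measure_pmf (bernoulli_pmf p)" "squares N"
    by unfold_locales
  \<comment> \<open>\<open>bernoulli_pmf\<close> clips its parameter to the unit interval, so a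
    negative \<open>p\<close> acts like 0.\<close>
  have qq: "bernoulli_pmf p = bernoulli_pmf q"
    unfolding q by (rule pmf_eqI) (simp add: bernoulli_pmf.rep_eq)
  have q01: "0 \<le> q" "q \<le> 1" using assms by auto
  let ?S = "square_set N J"
  have "(1 - q) ^ card J \<le> (1 - q) ^ card ?S"
    using q01 card_square_set[OF assms(2)] by (intro power_decreasing) auto
  also have "(1 - q) ^ card ?S = (\<Prod>i\<in>?S. measure (measure_pmf (bernoulli_pmf p)) {False})"
    using q01 by (simp add: qq measure_pmf_single)
  also have "\<dots> = measure (perc_measure N p) (prod_emb (squares N) (\<lambda>_. measure_pmf (bernoulli_pmf p)) ?S (Pi\<^sub>E ?S (\<lambda>_. {False})))"
    unfolding perc_measure_def
    by (rule measure_PiM_emb[symmetric]) (use assms square_set_subset finite_square_set in auto)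
  also have "prod_emb (squares N) (\<lambda>_. measure_pmf (bernoulli_pmf p)) ?S (Pi\<^sub>E ?S (\<lambda>_. {False}))
     = {\<omega> \<in> space (perc_measure N p). \<forall>(L, u, v)\<in>J. \<not> opn N \<omega> L u v}"
    (is "?A = ?B")
  proof -
    have eq: "(\<forall>i\<in>?S. \<omega> i = False) \<longleftrightarrow> (\<forall>(L, u, v)\<in>J. \<not> opn N \<omega> L u v)" for \<omega>
    proof
      assume *: "\<forall>i\<in>?S. \<omega> i = False"
      show "\<forall>(L, u, v)\<in>J. \<not> opn N \<omega> L u v"
      proof clarify
        fix L u v assume "(L, u, v) \<in> J" and o: "opn N \<omega> L u v"
        then have "(L, nat (u + 1), nat (v + 1)) \<in> ?S" unfolding square_set_def opn_def by blast
        with * o show False by (simp add: opn_def)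
      qed
    next
      assume "\<forall>(L, u, v)\<in>J. \<not> opn N \<omega> L u v"
      then show "\<forall>i\<in>?S. \<omega> i = False" unfolding square_set_def opn_def by blast
    qed
    have "prod_emb (squares N) (\<lambda>_. measure_pmf (bernoulli_pmf p)) ?S (Pi\<^sub>E ?S X) =
        {\<omega> \<in> space (perc_measure N p). \<forall>i\<in>?S. \<omega> i \<in> X i}" for X
      using square_set_subset[of N J] unfolding prod_emb_def
      by (auto simp: space_perc_measure restrict_PiE_iff)
    from this[of "\<lambda>_. {False}"] show ?thesis by (simp only: singleton_iff eq)
  qed
  finally show ?thesis .
qed

section \<open>Bad cells\<close>

lemma prob_ex_le:
  assumes "finite I" "\<And>x. x \<in> I \<Longrightarrow> depends_on N J (P x)" "finite J"
    and "\<And>x. x \<in> I \<Longrightarrow> prb N p (P x) \<le> c"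
  shows "prb N p (\<lambda>\<omega>. \<exists>x\<in>I. P x \<omega>) \<le> real (card I) * c"
proof -
  interpret prob_space "perc_measure N p" by (rule prob_space_perc_measure)
  have "{\<omega> \<in> space (perc_measure N p). \<exists>x\<in>I. P x \<omega>} = (\<Union>x\<in>I. {\<omega> \<in> space (perc_measure N p). P x \<omega>})"
    by auto
  then have "prb N p (\<lambda>\<omega>. \<exists>x\<in>I. P x \<omega>) \<le> (\<Sum>x\<in>I. prb N p (P x))"
    using assms depends_on_sets by (auto intro!: finite_measure_subadditive_finite)
  also have "\<dots> \<le> (\<Sum>x\<in>I. c)" by (intro sum_mono assms)
  finally show ?thesis by simp
qed

lemma prob_disj_le:
  assumes "depends_on N J P" "depends_on N J Q" "finite J"
  shows "prb N p (\<lambda>\<omega>. P \<omega> \<or> Q \<omega>) \<le> prb N p P + prb N p Q"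
proof -
  interpret prob_space "perc_measure N p" by (rule prob_space_perc_measure)
  have "{\<omega> \<in> space (perc_measure N p). P \<omega> \<or> Q \<omega>} =
     {\<omega> \<in> space (perc_measure N p). P \<omega>} \<union> {\<omega> \<in> space (perc_measure N p). Q \<omega>}" by auto
  then show ?thesis using assms depends_on_sets by (auto intro!: measure_Un_le)
qed

lemma prob_not_depends_on:
  assumes "depends_on N J P" "finite J"
  shows "prb N p (\<lambda>\<omega>. \<not> P \<omega>) = 1 - prb N p P"
proof -
  interpret prob_space "perc_measure N p" by (rule prob_space_perc_measure)
  show ?thesis using prob_neg[OF depends_on_sets[OF assms, of p]] .
qed

text \<open>Disjoint blocks are independent, and a block of at most \<open>c\<close> squares is
  completely closed with probability at least \<open>(1 - q) ^ c\<close>.\<close>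

lemma prob_blocks_open:
  assumes N: "N \<ge> 1" and fin: "\<And>i. finite (K i)" and card: "\<And>i. card (K i) \<le> c"
    and disj: "\<And>i i'. i < i' \<Longrightarrow> K i \<inter> K i' = {}" and p: "p \<le> 1" and q: "q = max 0 p"
  shows "prb N p (\<lambda>\<omega>. \<forall>i\<in>{1..k}. \<exists>(L, u, v)\<in>K i. opn N \<omega> L u v) \<le> (1 - (1 - q) ^ c) ^ k"
proof (induction k)
  case 0
  interpret prob_space "perc_measure N p" by (rule prob_space_perc_measure)
  show ?case by simp
next
  case (Suc k)
  interpret prob_space "perc_measure N p" by (rule prob_space_perc_measure)
  let ?E = "\<lambda>i \<omega>. \<exists>(L, u, v)\<in>K i. opn N \<omega> L u v"
  have q01: "0 \<le> q" "q \<le> 1" using p q by auto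
  have dE: "depends_on N (K i) (?E i)" for i
    by (intro depends_on_bex) (auto intro: depends_on_opn)
  have dE': "depends_on N (\<Union>i\<in>{1..k}. K i) (\<lambda>\<omega>. \<forall>i\<in>{1..k}. ?E i \<omega>)"
    by (intro depends_on_ball depends_on_mono[OF dE]) auto
  have "(1 - q) ^ c \<le> (1 - q) ^ card (K (Suc k))" using q01 card by (intro power_decreasing) auto
  also have "\<dots> \<le> prb N p (\<lambda>\<omega>. \<not> ?E (Suc k) \<omega>)"
    using prob_all_closed[OF N fin p q, of "Suc k"] by (simp add: case_prod_unfold)
  also have "\<dots> = 1 - prb N p (?E (Suc k))" by (rule prob_not_depends_on[OF dE fin])
  finally have 1: "prb N p (?E (Suc k)) \<le> 1 - (1 - q) ^ c" by simp
  have "{1..Suc k} = insert (Suc k) {1..k}" by auto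
  then have "prb N p (\<lambda>\<omega>. \<forall>i\<in>{1..Suc k}. ?E i \<omega>) = prb N p (\<lambda>\<omega>. (\<forall>i\<in>{1..k}. ?E i \<omega>) \<and> ?E (Suc k) \<omega>)"
    by (simp add: conj_commute)
  also have "\<dots> = prb N p (\<lambda>\<omega>. \<forall>i\<in>{1..k}. ?E i \<omega>) * prb N p (?E (Suc k))"
  proof (rule prob_conj_depends_on[OF N dE' _ dE])
    have "K i \<inter> K (Suc k) = {}" if "i \<in> {1..k}" for i using disj[of i "Suc k"] that by simp
    then show "(\<Union>i\<in>{1..k}. K i) \<inter> K (Suc k) = {}" by blast
  qed (use fin in auto)
  also have "\<dots> \<le> (1 - (1 - q) ^ c) ^ k * (1 - (1 - q) ^ c)"
    using 1 Suc.IH q01 by (intro mult_mono) (auto simp: power_le_one)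
  finally show ?case unfolding power_Suc2 .
qed

lemma le_div_iff_mult_le: "0 < K \<Longrightarrow> k \<le> w div K \<longleftrightarrow> k * K \<le> w" for k K w :: int
proof
  assume "0 < K" "k * K \<le> w"
  then show "k \<le> w div K" using zdiv_mono1[of "k * K" w K] by simp
next
  assume K: "0 < K" and "k \<le> w div K"
  then have "k * K \<le> w div K * K" by (intro mult_right_mono) auto
  also have "\<dots> \<le> w" using K by (metis Euclidean_Rings.pos_mod_sign div_mult_mod_eq le_add_same_cancel1)
  finally show "k * K \<le> w" .
qed

lemma div_window_iff:
  fixes K w a :: int
  assumes "0 < K"
  shows "\<bar>w div K - a\<bar> \<le> 2 \<longleftrightarrow> (a - 2) * K \<le> w \<and> w < (a + 3) * K"
  using le_div_iff_mult_le[OF assms, of "a - 2" w] le_div_iff_mult_le[OF assms, of "a + 3" w]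
  by (auto simp: abs_le_iff)

lemma line_open_cong:
  assumes "\<And>i u v. i \<in> {1..h div 20} \<Longrightarrow> \<bar>u - (X + 13 * int i)\<bar> \<le> 6 \<Longrightarrow>
     \<bar>v - (A + (S * (13 * int i)) div int h)\<bar> \<le> 6 \<Longrightarrow> P u v = Q u v"
  shows "line_open h P X A S = line_open h Q X A S"
  using assms unfolding line_open_def by blast

text \<open>The bound is \<open>2600 = 8 * 325\<close>: in \<open>piece_count\<close> a surplus of
  \<open>5 g / 8\<close> subpieces must leave \<open>g / 2\<close> after the loss of 324 bad ones
  and an incomplete last one.\<close>

locale renormalization =
  fixes N m :: nat and p :: real
  assumes N2: "N \<ge> 2" and g_large: "2600 \<le> N ^ m" and p1: "p < 1"
begin

definition g :: nat where "g = N ^ m"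

definition M :: nat where "M = N ^ (3 * m)"

lemma M_g: "M = g ^ 3" by (simp add: M_def g_def power_mult[symmetric] mult.commute)

lemma g_ge: "g \<ge> 40" using g_large by (simp add: g_def)

lemma M_ge: "M \<ge> 40"
proof -
  have "40 \<le> g * 1" using g_ge by simp
  also have "g * 1 \<le> g * g ^ 2" using g_ge by (intro mult_le_mono2) auto
  finally show ?thesis by (simp add: M_g eval_nat_numeral)
qed

lemma m_pos: "m \<ge> 1" using g_large by (cases m) auto

text \<open>All events attached to the cell \<open>(a, b)\<close> of scale \<open>n\<close>, a square of side \<open>1 / M ^ n\<close>, depend only on
  smaller squares inside the \<open>5 \<times> 5\<close> cells around it.\<close>

definition region :: "nat \<Rightarrow> nat \<Rightarrow> int \<Rightarrow> int \<Rightarrow> (nat \<times> int \<times> int) set" where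
  "region n j a b = {(L, u, v). 3 * m * n < L \<and> L \<le> 3 * m * (n + j) \<and>
     \<bar>u div int (N ^ (L - 3 * m * n)) - a\<bar> \<le> 2 \<and> \<bar>v div int (N ^ (L - 3 * m * n)) - b\<bar> \<le> 2}"

text \<open>The second alternative, with the coordinates exchanged, covers the lines of slope larger than 1.\<close>

definition straight :: "nat \<Rightarrow> int \<Rightarrow> int \<Rightarrow> (square \<Rightarrow> bool) \<Rightarrow> bool" where
  "straight n a b \<omega> \<longleftrightarrow>
    (\<exists>X\<in>{(a - 1) * int g..(a + 1) * int g + 1}. \<exists>A\<in>{(b - 1) * int g..(b + 2) * int g}. \<exists>S\<in>{- int g..int g}.
       line_open g (opn N \<omega> (3 * m * n + m)) X A S) \<or>
    (\<exists>X\<in>{(b - 1) * int g..(b + 1) * int g + 1}. \<exists>A\<in>{(a - 1) * int g..(a + 2) * int g}. \<exists>S\<in>{- int g..int g}.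
       line_open g (\<lambda>u v. opn N \<omega> (3 * m * n + m) v u) X A S)"

text \<open>A piece starting in cell \<open>a\<close> stays within one cell side of its start, hence
  in the three cells \<open>a - 1\<close>, \<open>a\<close>, \<open>a + 1\<close>, each of which
  contains \<open>M\<close> indices of the next scale.\<close>

definition children :: "int \<Rightarrow> int set" where
  "children a = {int M * (a - 1)..<int M * (a + 2)}"

text \<open>Cells whose indices differ by more than 4 have disjoint regions, so that they are independent.\<close>

definition two_far :: "(int \<Rightarrow> int \<Rightarrow> (square \<Rightarrow> bool) \<Rightarrow> bool) \<Rightarrow> int \<Rightarrow> int \<Rightarrow> (square \<Rightarrow> bool) \<Rightarrow> bool" where
  "two_far B a b \<omega> \<longleftrightarrow> (\<exists>((a1, b1), (a2, b2)) \<in> (children a \<times> children b) \<times> (children a \<times> children b).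
     (\<bar>a1 - a2\<bar> > 4 \<or> \<bar>b1 - b2\<bar> > 4) \<and> B a1 b1 \<omega> \<and> B a2 b2 \<omega>)"

text \<open>Two distant bad children are required rather than one. One bad child would multiply the
  probability by the number of children at every scale; two square it, which absorbs the number of
  pairs. The price is that bounded clusters of bad children have to be tolerated.\<close>

primrec bad :: "nat \<Rightarrow> nat \<Rightarrow> int \<Rightarrow> int \<Rightarrow> (square \<Rightarrow> bool) \<Rightarrow> bool" where
  "bad 0 = (\<lambda>n a b \<omega>. False)"
| "bad (Suc j) = (\<lambda>n a b \<omega>. straight n a b \<omega> \<or> two_far (bad j (Suc n)) a b \<omega>)"

text \<open>The probability that a cell is bad for some \<open>j\<close> is small but positive at every scale. The second
  recursion, along which it is squared, makes it small enough for a union bound over all cells of a scale.\<close>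

primrec very_bad :: "nat \<Rightarrow> nat \<Rightarrow> nat \<Rightarrow> int \<Rightarrow> int \<Rightarrow> (square \<Rightarrow> bool) \<Rightarrow> bool" where
  "very_bad 0 = bad"
| "very_bad (Suc i) = (\<lambda>j n a b \<omega>. two_far (very_bad i j (Suc n)) a b \<omega>)"

section \<open>Locality of the bad events\<close>

lemma finite_region: "finite (region n j a b)"
proof (rule finite_subset)
  show "region n j a b \<subseteq> (SIGMA L:{..3 * m * (n + j)}.
     {(a - 2) * int (N ^ (L - 3 * m * n))..(a + 3) * int (N ^ (L - 3 * m * n))} \<times>
     {(b - 2) * int (N ^ (L - 3 * m * n))..(b + 3) * int (N ^ (L - 3 * m * n))})"
    using N2 by (auto simp: region_def div_window_iff simp del: of_nat_power)
qed auto

lemma region_disjoint: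
  assumes "\<bar>a1 - a2\<bar> > 4 \<or> \<bar>b1 - b2\<bar> > 4"
  shows "region n j a1 b1 \<inter> region n j a2 b2 = {}"
proof -
  have "False" if "(L, u, v) \<in> region n j a1 b1" "(L, u, v) \<in> region n j a2 b2" for L u v
    using that assms unfolding region_def by (simp add: abs_le_iff abs_if split: if_splits)
  then show ?thesis by auto
qed

text \<open>Children reach one cell beyond \<open>a\<close>, and a margin of 2 fine cells around a
  child costs less than one further coarse cell. So windows of radius 2 reproduce themselves from
  scale to scale.\<close>

lemma child_window:
  assumes "a' \<in> children a" "\<bar>w - a'\<bar> \<le> 2"
  shows "\<bar>w div int M - a\<bar> \<le> 2"
proof -
  have "int M \<ge> 40" using M_ge by simp
  then show ?thesis using assms by (subst div_window_iff) (auto simp: children_def algebra_simps abs_le_iff)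
qed

lemma region_child:
  assumes "a' \<in> children a" "b' \<in> children b"
  shows "region (Suc n) j a' b' \<subseteq> region n (Suc j) a b"
proof clarify
  fix L u v assume "(L, u, v) \<in> region (Suc n) j a' b'"
  then have L: "3 * m * n + 3 * m < L" "L \<le> 3 * m * (n + Suc j)"
    and w: "\<bar>u div int (N ^ (L - 3 * m * Suc n)) - a'\<bar> \<le> 2" "\<bar>v div int (N ^ (L - 3 * m * Suc n)) - b'\<bar> \<le> 2"
    by (auto simp: region_def algebra_simps)
  have "L - 3 * m * n = (L - 3 * m * Suc n) + 3 * m" using L by (simp add: algebra_simps)
  then have "int (N ^ (L - 3 * m * n)) = int (N ^ (L - 3 * m * Suc n)) * int M"
    by (simp add: M_def power_add)
  then have "x div int (N ^ (L - 3 * m * n)) = x div int (N ^ (L - 3 * m * Suc n)) div int M" for x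
    by (simp add: zdiv_zmult2_eq del: of_nat_power)
  then show "(L, u, v) \<in> region n (Suc j) a b"
    using L child_window[OF assms(1) w(1)] child_window[OF assms(2) w(2)] unfolding region_def by simp
qed

lemma depends_on_two_far:
  assumes "\<And>a b. depends_on N (region (Suc n) j a b) (B a b)"
  shows "depends_on N (region n (Suc j) a b) (two_far B a b)"
proof -
  have *: "depends_on N (region n (Suc j) a b) (B a' b')" if "a' \<in> children a" "b' \<in> children b" for a' b'
    using depends_on_mono[OF assms region_child[OF that]] .
  show ?thesis
    unfolding depends_on_def
  proof (intro allI impI)
    fix \<omega> \<omega>' assume "\<forall>(L, u, v)\<in>region n (Suc j) a b. opn N \<omega> L u v = opn N \<omega>' L u v"
    then have "B a' b' \<omega> = B a' b' \<omega>'" if "a' \<in> children a" "b' \<in> children b" for a' b'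
      using *[OF that] unfolding depends_on_def by blast
    then show "two_far B a b \<omega> = two_far B a b \<omega>'" unfolding two_far_def by auto
  qed
qed

text \<open>As the slope is at most 1 and \<open>13 * i \<le> 0.65 g\<close>, the blocks reach at
  most \<open>0.65 g + 6 < g\<close> beyond the ranges of \<open>X\<close> and
  \<open>A\<close>.\<close>

lemma line_window:
  assumes a: "X \<in> {(a - 1) * int g..(a + 1) * int g + 1}" and b: "A \<in> {(b - 1) * int g..(b + 2) * int g}"
    and S: "S \<in> {- int g..int g}"
    and i: "i \<in> {1..g div 20}" and u: "\<bar>u - (X + 13 * int i)\<bar> \<le> 6"
    and v: "\<bar>v - (A + (S * (13 * int i)) div int g)\<bar> \<le> 6"
  shows "\<bar>u div int g - a\<bar> \<le> 2" "\<bar>v div int g - b\<bar> \<le> 2"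
proof -
  have g: "int g \<ge> 40" using g_ge by simp
  have i: "20 * int i \<le> int g" using i by auto
  show "\<bar>u div int g - a\<bar> \<le> 2"
    using a u i g by (subst div_window_iff) (auto simp: algebra_simps abs_le_iff)
  define V where "V = (S * (13 * int i)) div int g"
  have "- int g * (13 * int i) \<le> S * (13 * int i)" using S by (intro mult_right_mono) auto
  then have "- (13 * int i) \<le> V" unfolding V_def using g
    by (subst le_div_iff_mult_le) (auto simp: mult.commute)
  moreover have "S * (13 * int i) \<le> int g * (13 * int i)" using S by (intro mult_right_mono) auto
  then have "V \<le> 13 * int i" unfolding V_def using g zdiv_mono1[of "S * (13 * int i)" "int g * (13 * int i)" "int g"] by simp
  ultimately show "\<bar>v div int g - b\<bar> \<le> 2"
    using b v i g unfolding V_def[symmetric] by (subst div_window_iff) (auto simp: algebra_simps abs_le_iff)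
qed

lemma region_fine:
  assumes "\<bar>u div int g - a\<bar> \<le> 2" "\<bar>v div int g - b\<bar> \<le> 2"
  shows "(3 * m * n + m, u, v) \<in> region n (Suc j) a b"
  using assms m_pos by (simp add: region_def g_def algebra_simps)

lemma depends_on_line:
  assumes "X \<in> {(a - 1) * int g..(a + 1) * int g + 1}" "A \<in> {(b - 1) * int g..(b + 2) * int g}"
    "S \<in> {- int g..int g}"
  shows "depends_on N (region n (Suc j) a b) (\<lambda>\<omega>. line_open g (opn N \<omega> (3 * m * n + m)) X A S)"
    and "depends_on N (region n (Suc j) b a) (\<lambda>\<omega>. line_open g (\<lambda>u v. opn N \<omega> (3 * m * n + m) v u) X A S)"
  unfolding depends_on_def
  by (intro allI impI line_open_cong, use region_fine line_window[OF assms] in blast)+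

lemma depends_on_straight: "depends_on N (region n (Suc j) a b) (straight n a b)"
  unfolding depends_on_def
proof (intro allI impI)
  fix \<omega> \<omega>' assume *: "\<forall>(L, u, v)\<in>region n (Suc j) a b. opn N \<omega> L u v = opn N \<omega>' L u v"
  show "straight n a b \<omega> = straight n a b \<omega>'"
    unfolding straight_def
    by (intro arg_cong2[where f = "(\<or>)"] bex_cong refl
        depends_on_line(1)[unfolded depends_on_def, rule_format]
        depends_on_line(2)[unfolded depends_on_def, rule_format]) (use * in blast)+
qed

lemma depends_on_bad: "depends_on N (region n j a b) (bad j n a b)"
proof (induction j arbitrary: n a b)
  case (Suc j)
  then show ?case by (auto intro!: depends_on_disj depends_on_straight depends_on_two_far)
qed (simp add: depends_on_const)

lemma depends_on_very_bad: "depends_on N (region n (j + i) a b) (very_bad i j n a b)"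
proof (induction i arbitrary: n a b)
  case (Suc i)
  show ?case using depends_on_two_far[of n "j + i", OF Suc] by simp
qed (simp add: depends_on_bad)

section \<open>Probabilities of the bad events\<close>

definition \<theta> :: real where "\<theta> = 1 - (1 - max 0 p) ^ 169"

text \<open>\<open>\<theta>\<close> bounds the probability that a block of
  \<open>13 * 13 = 169\<close> cells is not completely closed, and a line carries
  \<open>g div 20\<close> independent blocks. The factor is \<open>72 = 2 * 36\<close>: each of the
  two orientations in \<open>straight\<close> has at most \<open>36 g^3\<close> lines.\<close>

definition \<rho> :: real where "\<rho> = 72 * real g ^ 3 * \<theta> ^ (g div 20)"

lemma prob_line_le:
  "prb N p (\<lambda>\<omega>. line_open g (opn N \<omega> L) X A S) \<le> \<theta> ^ (g div 20)"
  "prb N p (\<lambda>\<omega>. line_open g (\<lambda>u v. opn N \<omega> L v u) X A S) \<le> \<theta> ^ (g div 20)"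
proof -
  define I where "I = (\<lambda>i. {X + 13 * int i - 6..X + 13 * int i + 6})"
  define I' where "I' = (\<lambda>i. {A + (S * (13 * int i)) div int g - 6..A + (S * (13 * int i)) div int g + 6})"
  have c: "card (I i) = 13" "card (I' i) = 13" "finite (I i)" "finite (I' i)" for i
    by (auto simp: I_def I'_def)
  have "I i \<inter> I i' = {}" if "i < i'" for i i' using that by (auto simp: I_def)
  then have d: "({L} \<times> I i \<times> I' i) \<inter> ({L} \<times> I i' \<times> I' i') = {}"
    "({L} \<times> I' i \<times> I i) \<inter> ({L} \<times> I' i' \<times> I i') = {}" if "i < i'" for i i'
    using that by blast+
  have II: "u \<in> I i \<longleftrightarrow> \<bar>u - (X + 13 * int i)\<bar> \<le> 6" for u i by (auto simp: I_def)
  have II': "u \<in> I' i \<longleftrightarrow> \<bar>u - (A + (S * (13 * int i)) div int g)\<bar> \<le> 6" for u i by (auto simp: I'_def)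
  have ex: "(\<exists>(L, u, v)\<in>{L} \<times> U \<times> V. Q L u v) \<longleftrightarrow> (\<exists>u v. Q L u v \<and> u \<in> U \<and> v \<in> V)" for U V :: "int set" and Q
    by auto
  have N: "N \<ge> 1" and p: "p \<le> 1" using N2 p1 by auto
  have "prb N p (\<lambda>\<omega>. \<forall>i\<in>{1..g div 20}. \<exists>(L, u, v)\<in>{L} \<times> I i \<times> I' i. opn N \<omega> L u v) \<le> \<theta> ^ (g div 20)"
    unfolding \<theta>_def
    by (rule prob_blocks_open[OF N _ _ _ p refl]) (use d in \<open>auto simp: card_cartesian_product c\<close>)
  moreover have "line_open g (opn N \<omega> L) X A S \<longleftrightarrow> (\<forall>i\<in>{1..g div 20}. \<exists>(L, u, v)\<in>{L} \<times> I i \<times> I' i. opn N \<omega> L u v)" for \<omega>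
    unfolding line_open_def ex II II' by (rule ball_cong[OF refl]) auto
  ultimately show "prb N p (\<lambda>\<omega>. line_open g (opn N \<omega> L) X A S) \<le> \<theta> ^ (g div 20)" by simp
  have "prb N p (\<lambda>\<omega>. \<forall>i\<in>{1..g div 20}. \<exists>(L, u, v)\<in>{L} \<times> I' i \<times> I i. opn N \<omega> L u v) \<le> \<theta> ^ (g div 20)"
    unfolding \<theta>_def
    by (rule prob_blocks_open[OF N _ _ _ p refl]) (use d in \<open>auto simp: card_cartesian_product c\<close>)
  moreover have "line_open g (\<lambda>u v. opn N \<omega> L v u) X A S \<longleftrightarrow> (\<forall>i\<in>{1..g div 20}. \<exists>(L, u, v)\<in>{L} \<times> I' i \<times> I i. opn N \<omega> L u v)" for \<omega>
    unfolding line_open_def ex II II' by (rule ball_cong[OF refl]) auto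
  ultimately show "prb N p (\<lambda>\<omega>. line_open g (\<lambda>u v. opn N \<omega> L v u) X A S) \<le> \<theta> ^ (g div 20)" by simp
qed

lemma \<theta>_nonneg: "0 \<le> \<theta>" "\<theta> < 1"
  using p1 by (auto simp: \<theta>_def power_le_one)

lemma prob_straight_le: "prb N p (straight n a b) \<le> \<rho>"
proof -
  define T where "T = (\<lambda>a b. {(a - 1) * int g..(a + 1) * int g + 1} \<times> {(b - 1) * int g..(b + 2) * int g} \<times> {- int g..int g})"
  have "(a + 1) * int g + 1 - (a - 1) * int g + 1 = int (2 * g + 2)" "(b + 2) * int g - (b - 1) * int g + 1 = int (3 * g + 1)"
    "int g - - int g + 1 = int (2 * g + 1)" for a b by (auto simp: algebra_simps)
  then have cT: "card (T a b) = (2 * g + 2) * ((3 * g + 1) * (2 * g + 1))" for a b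
    unfolding T_def by (simp only: card_cartesian_product card_atLeastAtMost_int nat_int)
  have fT: "finite (T a b)" for a b by (auto simp: T_def)
  have "(2 * g + 2) * ((3 * g + 1) * (2 * g + 1)) \<le> (3 * g) * ((4 * g) * (3 * g))"
    using g_ge by (intro mult_le_mono) auto
  then have "card (T a b) \<le> 36 * g ^ 3" for a b by (simp add: cT power3_eq_cube)
  then have "real (card (T a b)) \<le> real (36 * g ^ 3)" for a b by (subst of_nat_le_iff)
  then have cT': "real (card (T a b)) * \<theta> ^ (g div 20) \<le> 36 * real g ^ 3 * \<theta> ^ (g div 20)" for a b
    using \<theta>_nonneg by (intro mult_right_mono) auto
  let ?L = "3 * m * n + m"
  let ?P = "\<lambda>(X, A, S) \<omega>. line_open g (opn N \<omega> ?L) X A S"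
  let ?Q = "\<lambda>(X, A, S) \<omega>. line_open g (\<lambda>u v. opn N \<omega> ?L v u) X A S"
  have dP: "depends_on N (region n 1 a b) (?P x)" if "x \<in> T a b" for x
    using depends_on_line(1)[of _ a _ b _ n 0] that by (auto simp: T_def)
  have dQ: "depends_on N (region n 1 a b) (?Q x)" if "x \<in> T b a" for x
    using depends_on_line(2)[of _ b _ a _ n 0] that by (auto simp: T_def)
  have eq: "straight n a b = (\<lambda>\<omega>. (\<exists>x\<in>T a b. ?P x \<omega>) \<or> (\<exists>x\<in>T b a. ?Q x \<omega>))"
    unfolding straight_def T_def by (rule ext) simp
  have dep: "depends_on N (region n 1 a b) (\<lambda>\<omega>. \<exists>x\<in>T a b. ?P x \<omega>)" "depends_on N (region n 1 a b) (\<lambda>\<omega>. \<exists>x\<in>T b a. ?Q x \<omega>)"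
    by (intro depends_on_bex dP dQ; assumption)+
  have "prb N p (straight n a b) \<le> prb N p (\<lambda>\<omega>. \<exists>x\<in>T a b. ?P x \<omega>) + prb N p (\<lambda>\<omega>. \<exists>x\<in>T b a. ?Q x \<omega>)"
    unfolding eq by (rule prob_disj_le[OF dep finite_region])
  also have "\<dots> \<le> real (card (T a b)) * \<theta> ^ (g div 20) + real (card (T b a)) * \<theta> ^ (g div 20)"
    by (intro add_mono prob_ex_le[OF fT dP finite_region] prob_ex_le[OF fT dQ finite_region])
      (auto intro: prob_line_le)
  also have "\<dots> \<le> \<rho>" using cT'[of a b] cT'[of b a] by (simp add: \<rho>_def)
  finally show ?thesis .
qed

text \<open>Union bound over at most \<open>(9 M^2)^2 = 81 g^12\<close> ordered pairs of children;
  distant children have disjoint regions, so each pair contributes at most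
  \<open>c^2\<close>.\<close>

lemma prob_two_far_le:
  assumes dep: "\<And>a b. depends_on N (region (Suc n) j a b) (B a b)"
    and B: "\<And>a b. prb N p (B a b) \<le> c"
  shows "prb N p (two_far B a b) \<le> 81 * real g ^ 12 * c\<^sup>2"
proof -
  define T where "T = {((a1, b1), (a2, b2)) \<in> (children a \<times> children b) \<times> (children a \<times> children b).
     \<bar>a1 - a2\<bar> > 4 \<or> \<bar>b1 - b2\<bar> > 4}"
  have cc: "card (children a) = 3 * M" "finite (children a)" for a
    by (auto simp: children_def algebra_simps)
  have sub: "T \<subseteq> (children a \<times> children b) \<times> (children a \<times> children b)" by (auto simp: T_def)
  then have fT: "finite T" by (rule finite_subset) (auto simp: cc)
  have "card T \<le> card ((children a \<times> children b) \<times> (children a \<times> children b))"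
    by (rule card_mono[OF _ sub]) (auto simp: cc)
  also have "\<dots> = (3 * M) * (3 * M) * ((3 * M) * (3 * M))" by (simp only: card_cartesian_product cc)
  also have "\<dots> = 81 * M ^ 4" by (simp add: power4_eq_xxxx)
  also have "\<dots> = 81 * g ^ 12" by (simp add: M_g power_mult[symmetric])
  finally have cT: "card T \<le> 81 * g ^ 12" .
  let ?P = "\<lambda>((a1, b1), (a2, b2)) \<omega>. B a1 b1 \<omega> \<and> B a2 b2 \<omega>"
  have eq: "two_far B a b = (\<lambda>\<omega>. \<exists>x\<in>T. ?P x \<omega>)"
    unfolding two_far_def T_def by (rule ext) auto
  have "prb N p (\<lambda>\<omega>. \<exists>x\<in>T. ?P x \<omega>) \<le> real (card T) * c\<^sup>2"
  proof (rule prob_ex_le[OF fT _ finite_region])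
    fix x assume x: "x \<in> T"
    obtain a1 b1 a2 b2 where xx: "x = ((a1, b1), (a2, b2))" by (metis surj_pair)
    have far: "\<bar>a1 - a2\<bar> > 4 \<or> \<bar>b1 - b2\<bar> > 4" using x xx by (auto simp: T_def)
    show "depends_on N (region n (Suc j) a b) (?P x)"
      using x xx by (auto simp: T_def intro!: depends_on_conj depends_on_mono[OF dep region_child])
    have "prb N p (?P x) = prb N p (B a1 b1) * prb N p (B a2 b2)"
      unfolding xx using prob_conj_depends_on[OF _ dep finite_region dep finite_region region_disjoint[OF far]] N2 by simp
    also have "\<dots> \<le> c * c" using B by (intro mult_mono order_trans[OF measure_nonneg B]) auto
    finally show "prb N p (?P x) \<le> c\<^sup>2" by (simp add: power2_eq_square)
  qed
  also have "\<dots> \<le> 81 * real g ^ 12 * c\<^sup>2"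
    using cT[folded of_nat_le_iff[where ?'a = real]] by (intro mult_right_mono) auto
  finally show ?thesis unfolding eq .
qed

lemma two_farI:
  assumes "a1 \<in> children a" "b1 \<in> children b" "a2 \<in> children a" "b2 \<in> children b"
    and "\<bar>a1 - a2\<bar> > 4 \<or> \<bar>b1 - b2\<bar> > 4" "B a1 b1 \<omega>" "B a2 b2 \<omega>"
  shows "two_far B a b \<omega>"
  unfolding two_far_def by (rule bexI[of _ "((a1, b1), (a2, b2))"]) (use assms in auto)

lemma two_far_mono: "two_far B a b \<omega> \<Longrightarrow> (\<And>a b. B a b \<omega> \<Longrightarrow> C a b \<omega>) \<Longrightarrow> two_far C a b \<omega>"
  unfolding two_far_def by blast

text \<open>Monotonicity in the number of inspected scales turns the union over \<open>j\<close>
  into an increasing one and brings two witnesses of badness to a common \<open>j\<close>.\<close>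

lemma bad_Suc: "bad j n a b \<omega> \<Longrightarrow> bad (Suc j) n a b \<omega>"
proof (induction j arbitrary: n a b)
  case (Suc j)
  have unfold: "bad (Suc j) n a b \<omega> \<longleftrightarrow> straight n a b \<omega> \<or> two_far (bad j (Suc n)) a b \<omega>" for j by simp
  have "two_far (bad (Suc j) (Suc n)) a b \<omega>" if "two_far (bad j (Suc n)) a b \<omega>"
    using that by (rule two_far_mono) (rule Suc.IH)
  then show ?case using Suc.prems unfolding unfold by blast
qed simp

lemma very_bad_Suc: "very_bad i j n a b \<omega> \<Longrightarrow> very_bad i (Suc j) n a b \<omega>"
proof (induction i arbitrary: n a b)
  case 0
  then show ?case using bad_Suc by simp
next
  case (Suc i)
  then show ?case by (auto elim: two_far_mono)
qed

lemma very_bad_mono: "j \<le> j' \<Longrightarrow> very_bad i j n a b \<omega> \<Longrightarrow> very_bad i j' n a b \<omega>"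
  by (induction j' rule: dec_induct) (auto intro: very_bad_Suc)

lemma \<rho>_nonneg: "\<rho> \<ge> 0" using \<theta>_nonneg by (simp add: \<rho>_def)

text \<open>The bound \<open>2 \<rho>\<close> reproduces itself:
  \<open>\<rho> + 81 g^12 (2 \<rho>)^2 \<le> 2 \<rho>\<close> is what \<open>small\<close>
  provides.\<close>

lemma prob_bad_le:
  assumes small: "324 * real g ^ 12 * \<rho> \<le> 1"
  shows "prb N p (bad j n a b) \<le> 2 * \<rho>"
proof (induction j arbitrary: n a b)
  case (Suc j)
  have "prb N p (bad (Suc j) n a b) \<le> prb N p (straight n a b) + prb N p (two_far (bad j (Suc n)) a b)"
    using prob_disj_le[OF depends_on_straight depends_on_two_far[OF depends_on_bad] finite_region] by simp
  also have "\<dots> \<le> \<rho> + 81 * real g ^ 12 * (2 * \<rho>)\<^sup>2"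
    by (intro add_mono prob_straight_le prob_two_far_le[OF depends_on_bad] Suc)
  also have "81 * real g ^ 12 * (2 * \<rho>)\<^sup>2 = (324 * real g ^ 12 * \<rho>) * \<rho>" by (simp add: power2_eq_square)
  also have "\<dots> \<le> 1 * \<rho>" using small \<rho>_nonneg by (intro mult_right_mono) auto
  finally show ?case by simp
qed (simp add: \<rho>_nonneg)

text \<open>After multiplication by \<open>81 g^12\<close> the recursion of
  \<open>prob_two_far_le\<close> is plain squaring, and by \<open>small\<close> the initial value
  \<open>162 g^12 \<rho>\<close> is at most 1/2.\<close>

lemma prob_very_bad_le:
  assumes small: "324 * real g ^ 12 * \<rho> \<le> 1"
  shows "81 * real g ^ 12 * prb N p (very_bad i j n a b) \<le> (1 / 2) ^ (2 ^ i)"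
proof (induction i arbitrary: n a b)
  case 0
  have "81 * real g ^ 12 * prb N p (bad j n a b) \<le> 81 * real g ^ 12 * (2 * \<rho>)"
    by (intro mult_left_mono prob_bad_le[OF small]) auto
  also have "\<dots> = (324 * real g ^ 12 * \<rho>) / 2" by simp
  also have "\<dots> \<le> 1 / 2" using small by (intro divide_right_mono) auto
  finally show ?case by simp
next
  case (Suc i)
  define C where "C = 81 * real g ^ 12"
  have C: "C > 0" using g_ge by (simp add: C_def)
  have "prb N p (very_bad i j (Suc n) a b) \<le> (1 / 2) ^ (2 ^ i) / C" for a b
    using Suc[of "Suc n" a b] C by (simp add: C_def field_simps)
  then have "prb N p (very_bad (Suc i) j n a b) \<le> C * ((1 / 2) ^ (2 ^ i) / C)\<^sup>2"
    unfolding C_def very_bad.simps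
    by (intro prob_two_far_le[OF depends_on_very_bad]) (simp add: C_def)
  then have "C * prb N p (very_bad (Suc i) j n a b) \<le> C * (C * ((1 / 2) ^ (2 ^ i) / C)\<^sup>2)"
    using C by (intro mult_left_mono) auto
  also have "\<dots> = ((1 / 2) ^ (2 ^ i))\<^sup>2" using C by (simp add: power2_eq_square)
  also have "\<dots> = (1 / 2) ^ (2 ^ Suc i)" by (simp add: power_mult[symmetric] mult.commute)
  finally show ?case by (simp add: C_def)
qed

end

section \<open>Paths from good cells\<close>

lemma perc_limit_opn:
  assumes "x \<in> perc_limit N \<omega>" "L \<ge> 1" "N \<ge> 1"
  shows "\<exists>u v. opn N \<omega> L u v \<and> u \<le> fst x * real (N ^ L) \<and> fst x * real (N ^ L) \<le> u + 1 \<and>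
     v \<le> snd x * real (N ^ L) \<and> snd x * real (N ^ L) \<le> v + 1"
proof -
  have pos: "real (N ^ L) > 0" using assms(3) by simp
  from assms obtain Q where Q: "Q \<in> squares N" "fst Q = L" "\<omega> Q" "x \<in> cell N Q"
    unfolding perc_limit_def perc_level_def by fastforce
  then obtain k1 k2 where QQ: "Q = (L, k1, k2)" by (metis prod.collapse)
  have k: "1 \<le> k1" "k1 \<le> N ^ L" "1 \<le> k2" "k2 \<le> N ^ L" using Q(1) by (auto simp: squares_def QQ)
  have "nat (int k1 - 1 + 1) = k1" "nat (int k2 - 1 + 1) = k2" by auto
  then have "opn N \<omega> L (int k1 - 1) (int k2 - 1)"
    using k Q(3) assms(2) by (simp add: opn_def QQ flip: of_nat_power)
  moreover have "(real k1 - 1) / real (N ^ L) \<le> fst x" "fst x \<le> real k1 / real (N ^ L)"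
    "(real k2 - 1) / real (N ^ L) \<le> snd x" "snd x \<le> real k2 / real (N ^ L)"
    using Q(4) by (auto simp: QQ mem_Times_iff simp del: of_nat_power)
  ultimately show ?thesis using pos
    by (intro exI[of _ "int k1 - 1"] exI[of _ "int k2 - 1"]) (simp add: pos_divide_le_eq pos_le_divide_eq)
qed

lemma dist_chain_le:
  fixes z :: "nat \<Rightarrow> 'a::metric_space"
  assumes "\<And>i. i < k \<Longrightarrow> dist (z i) (z (Suc i)) \<le> r" "i \<le> j" "j \<le> k"
  shows "dist (z i) (z j) \<le> real (j - i) * r"
  using assms(2,3)
proof (induction j rule: dec_induct)
  case (step j)
  have "dist (z i) (z (Suc j)) \<le> dist (z i) (z j) + dist (z j) (z (Suc j))" by (rule dist_triangle)
  also have "\<dots> \<le> real (j - i) * r + r" using step assms(1)[of j] by (intro add_mono) auto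
  finally show ?case using step by (simp add: Suc_diff_le algebra_simps)
qed simp

lemma dist_le_coord_sum:
  fixes x y :: "real \<times> real"
  shows "dist x y \<le> \<bar>fst x - fst y\<bar> + \<bar>snd x - snd y\<bar>"
  unfolding dist_prod_def dist_real_def using sqrt_sum_squares_le_sum_abs by simp

context renormalization
begin

text \<open>A chain without a detour stays in a thin ellipse around the segment between its ends, hence close to
  a discretised line, and must meet every block along this line.\<close>

lemma not_straight_detour:
  fixes z :: "nat \<Rightarrow> real \<times> real"
  assumes lim: "\<And>i. i \<le> k \<Longrightarrow> z i \<in> perc_limit N \<omega>"
    and step: "\<And>i. i < k \<Longrightarrow> dist (z i) (z (Suc i)) \<le> 1 / (real g * real M ^ n)"
    and d: "dist (z 0) (z k) = 1 / real M ^ n"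
    and ns: "\<not> straight n \<lfloor>fst (z 0) * real M ^ n\<rfloor> \<lfloor>snd (z 0) * real M ^ n\<rfloor> \<omega>"
  shows "\<exists>i\<le>k. (1 + 1 / (real g)\<^sup>2) / real M ^ n \<le> dist (z 0) (z i) + dist (z i) (z k)"
proof (rule ccontr)
  assume no: "\<not> ?thesis"
  define a where "a = \<lfloor>fst (z 0) * real M ^ n\<rfloor>"
  define b where "b = \<lfloor>snd (z 0) * real M ^ n\<rfloor>"
  define K where "K = real g * real M ^ n"
  define L where "L = 3 * m * n + m"
  have g0: "real g > 0" using g_ge by simp
  have M0: "real M ^ n > 0" using M_ge by simp
  have K0: "K > 0" using g0 M0 by (simp add: K_def)
  have K: "K = real (N ^ L)"
    by (simp add: K_def L_def g_def M_def power_add power_mult[symmetric] mult.commute)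
  \<comment> \<open>In this scaling the squares of level \<open>L\<close> have side 1 and the ends
    of the chain are at distance \<open>g\<close>.\<close>
  define w where "w = (\<lambda>i. K *\<^sub>R z i)"
  have dw: "dist (w i) (w j) = K * dist (z i) (z j)" for i j
    using K0 by (simp add: w_def dist_norm scaleR_diff_right[symmetric] del: scaleR_diff_right)
  have fw: "fst (w i) = fst (z i) * K" "snd (w i) = snd (z i) * K" for i by (simp_all add: w_def)
  have L1: "L \<ge> 1" using m_pos by (simp add: L_def)
  have cells: "\<exists>u v. opn N \<omega> L u v \<and> u \<le> fst (w i) \<and> fst (w i) \<le> u + 1 \<and> v \<le> snd (w i) \<and> snd (w i) \<le> v + 1"
    if "i \<le> k" for i
    using perc_limit_opn[OF lim[OF that] L1] N2 unfolding fw K by simp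
  have step': "dist (w i) (w (Suc i)) \<le> 1" if "i < k" for i
    using step[OF that] K0 unfolding dw K_def[symmetric] by (simp add: field_simps)
  have d': "dist (w 0) (w k) = real g" using M0 by (simp add: dw d K_def)
  have ell: "dist (w 0) (w i) + dist (w i) (w k) < (1 + 1 / (real g)\<^sup>2) * real g" if "i \<le> k" for i
  proof -
    have "dist (z 0) (z i) + dist (z i) (z k) < (1 + 1 / (real g)\<^sup>2) / real M ^ n" using no that by force
    then have "K * (dist (z 0) (z i) + dist (z i) (z k)) < K * ((1 + 1 / (real g)\<^sup>2) / real M ^ n)"
      using K0 by (intro mult_strict_left_mono)
    moreover have "K * (c / real M ^ n) = c * real g" for c
    proof -
      have "real g * P * (c / P) = c * real g" if "P > 0" for P :: real using that by simp
      from this[OF M0] show ?thesis by (simp only: K_def)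
    qed
    ultimately show ?thesis unfolding dw distrib_left[symmetric] by (simp only:)
  qed
  have "of_int a * real g \<le> fst (w 0)" "fst (w 0) < (of_int a + 1) * real g"
    "of_int b * real g \<le> snd (w 0)" "snd (w 0) < (of_int b + 1) * real g"
  proof -
    have "of_int a \<le> fst (z 0) * real M ^ n" "fst (z 0) * real M ^ n < of_int a + 1"
      "of_int b \<le> snd (z 0) * real M ^ n" "snd (z 0) * real M ^ n < of_int b + 1"
      by (auto simp: a_def b_def)
    from mult_right_mono[OF this(1), of "real g"] mult_strict_right_mono[OF this(2), of "real g"]
      mult_right_mono[OF this(3), of "real g"] mult_strict_right_mono[OF this(4), of "real g"]
    show "of_int a * real g \<le> fst (w 0)" "fst (w 0) < (of_int a + 1) * real g"
      "of_int b * real g \<le> snd (w 0)" "snd (w 0) < (of_int b + 1) * real g"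
      using g0 by (simp_all add: fw K_def mult_ac)
  qed
  note box = this
  show False
  proof (cases "\<bar>snd (w k) - snd (w 0)\<bar> \<le> \<bar>fst (w k) - fst (w 0)\<bar>")
    case True
    from straight_chain_line_open[OF g_ge cells step' d' ell True box]
    show False using ns unfolding straight_def a_def[symmetric] b_def[symmetric] L_def[symmetric] by blast
  next
    case False
    define w' where "w' = (\<lambda>i. prod.swap (w i))"
    have dw': "dist (w' i) (w' j) = dist (w i) (w j)" for i j
      by (simp add: w'_def dist_prod_def add.commute)
    have cells': "\<exists>u v. opn N \<omega> L v u \<and> u \<le> fst (w' i) \<and> fst (w' i) \<le> u + 1 \<and> v \<le> snd (w' i) \<and> snd (w' i) \<le> v + 1"
      if "i \<le> k" for i
      using cells[OF that] by (auto simp: w'_def)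
    have dom: "\<bar>snd (w' k) - snd (w' 0)\<bar> \<le> \<bar>fst (w' k) - fst (w' 0)\<bar>"
      using False by (simp add: w'_def)
    have box': "of_int b * real g \<le> fst (w' 0)" "fst (w' 0) < (of_int b + 1) * real g"
      "of_int a * real g \<le> snd (w' 0)" "snd (w' 0) < (of_int a + 1) * real g"
      using box by (auto simp: w'_def)
    from straight_chain_line_open[of g k "\<lambda>u v. opn N \<omega> L v u" w', OF g_ge cells' _ _ _ dom box']
    show False using ns step' d' ell
      unfolding straight_def a_def[symmetric] b_def[symmetric] L_def[symmetric] dw' by blast
  qed
qed

text \<open>A compromise: consecutive subpieces start \<open>1 + \<epsilon>\<close> piece lengths
  apart, which leaves gaps of \<open>\<epsilon>\<close> piece lengths but costs only a quarter of
  the relative gain \<open>1 / g^2\<close> of a detour.\<close>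

definition \<epsilon> :: real where "\<epsilon> = 1 / (4 * (real g)\<^sup>2)"

definition ix :: "nat \<Rightarrow> real \<Rightarrow> int" where "ix n x = \<lfloor>x * real M ^ n\<rfloor>"

lemma ix_children:
  assumes "\<bar>x - y\<bar> \<le> 1 / real M ^ n"
  shows "ix (Suc n) y \<in> children (ix n x)"
proof -
  have M0: "real M ^ n > 0" "real M > 0" using M_ge by auto
  define w where "w = y * real M ^ n"
  have "\<bar>x - y\<bar> * real M ^ n \<le> 1" using assms M0 by (simp add: field_simps)
  then have "\<bar>x * real M ^ n - w\<bar> \<le> 1"
    using M0 by (simp add: w_def abs_mult[symmetric] left_diff_distrib abs_if split: if_splits)
  then have w: "of_int (ix n x) - 1 \<le> w" "w < of_int (ix n x) + 2"
    unfolding ix_def by linarith+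
  have le: "real M * (of_int (ix n x) - 1) \<le> real M * w" "real M * w < real M * (of_int (ix n x) + 2)"
    using w M0 by (intro mult_left_mono mult_strict_left_mono; simp)+
  have eq: "y * real M ^ Suc n = real M * w" by (simp add: w_def)
  have "of_int (int M * (ix n x - 1)) \<le> y * real M ^ Suc n" "y * real M ^ Suc n < of_int (int M * (ix n x + 2))"
    unfolding eq using le by simp_all
  then have "int M * (ix n x - 1) \<le> ix (Suc n) y" "ix (Suc n) y < int M * (ix n x + 2)"
    unfolding ix_def[of "Suc n"] by (simp_all only: le_floor_iff floor_less_iff)
  then show ?thesis by (simp add: children_def)
qed

lemma children_of_close_point:
  assumes "dist x y \<le> 1 / real M ^ n"
  shows "ix (Suc n) (fst y) \<in> children (ix n (fst x))" "ix (Suc n) (snd y) \<in> children (ix n (snd x))"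
  using assms dist_fst_le[of x y] dist_snd_le[of x y] by (auto intro!: ix_children simp: dist_real_def)

text \<open>Pigeonhole on the grid of half the cell side, where two points of one square are closer
  than \<open>1 / M ^ n\<close>. Indices within 4 of a given one leave 18 half cells per coordinate,
  and \<open>18 * 18 = 324\<close>.\<close>

lemma card_bad_points_le:
  fixes z :: "nat \<Rightarrow> real \<times> real"
  assumes fin: "finite I"
    and sep: "\<And>i j. i \<in> I \<Longrightarrow> j \<in> I \<Longrightarrow> i < j \<Longrightarrow> 1 / real M ^ n \<le> dist (z i) (z j)"
    and near: "\<And>i j. i \<in> I \<Longrightarrow> j \<in> I \<Longrightarrow> \<bar>ix n (fst (z i)) - ix n (fst (z j))\<bar> \<le> 4 \<and>
       \<bar>ix n (snd (z i)) - ix n (snd (z j))\<bar> \<le> 4"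
  shows "card I \<le> 324"
proof (cases "I = {}")
  case False
  then obtain i0 where i0: "i0 \<in> I" by auto
  have M0: "real M ^ n > 0" using M_ge by simp
  define h where "h = (\<lambda>x. \<lfloor>2 * (x * real M ^ n)\<rfloor>)"
  have h: "2 * ix n x \<le> h x" "h x \<le> 2 * ix n x + 1" for x unfolding h_def ix_def by linarith+
  define R where "R = (\<lambda>x. {2 * ix n x - 8..2 * ix n x + 9})"
  define F where "F = (\<lambda>i. (h (fst (z i)), h (snd (z i))))"
  have close: "\<bar>x - y\<bar> < 1 / real M ^ n / 2" if "h x = h y" for x y
  proof -
    have "\<bar>2 * (x * real M ^ n) - 2 * (y * real M ^ n)\<bar> < 1"
      using that unfolding h_def by linarith
    then have "\<bar>x - y\<bar> * real M ^ n * 2 < 1"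
      using M0 by (simp add: abs_mult left_diff_distrib abs_if mult_less_0_iff split: if_splits)
    then show ?thesis using M0 by (simp add: field_simps)
  qed
  have F_far: "F i \<noteq> F j" if "i \<in> I" "j \<in> I" "i < j" for i j
  proof
    assume "F i = F j"
    then have "dist (z i) (z j) < 1 / real M ^ n"
      using dist_le_coord_sum[of "z i" "z j"] close[of "fst (z i)" "fst (z j)"] close[of "snd (z i)" "snd (z j)"]
      by (simp add: F_def)
    with sep[OF that] show False by simp
  qed
  have "inj_on F I"
    using F_far by (intro inj_onI) (metis linorder_neqE_nat)
  moreover have "F ` I \<subseteq> R (fst (z i0)) \<times> R (snd (z i0))"
  proof (rule image_subsetI)
    fix i assume "i \<in> I"
    from near[OF this i0] show "F i \<in> R (fst (z i0)) \<times> R (snd (z i0))"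
      using h[of "fst (z i)"] h[of "snd (z i)"] by (auto simp: F_def R_def abs_le_iff)
  qed
  ultimately have "card I \<le> card (R (fst (z i0)) \<times> R (snd (z i0)))"
    by (intro card_inj_on_le) (auto simp: R_def)
  also have "\<dots> = 324" by (simp add: card_cartesian_product R_def)
  finally show ?thesis .
qed simp

text \<open>With \<open>\<delta> = 1 / g^2\<close> one has \<open>\<delta> * M = g\<close> and
  \<open>(1 + 5 \<delta> / 8) * (1 + \<delta> / 4) \<le> 1 + \<delta>\<close>. So
  \<open>Suc k\<close> is at least \<open>M + 5 g / 8\<close>, and \<open>g / 8 \<ge> 325\<close>
  covers the 324 and the step from \<open>Suc k\<close> to \<open>k\<close>.\<close>

lemma piece_count:
  assumes "(1 + 1 / (real g)\<^sup>2) * real M \<le> real (Suc k) * (1 + \<epsilon>)"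
  shows "(1 + 1 / (2 * (real g)\<^sup>2)) * real M + 324 \<le> real k"
proof -
  define \<delta> where "\<delta> = 1 / (real g)\<^sup>2"
  have g: "real g \<ge> 2600" using g_large by (simp add: g_def flip: of_nat_power)
  have "(real g)\<^sup>2 \<ge> 1" using g by (intro one_le_power) auto
  then have \<delta>: "0 < \<delta>" "\<delta> \<le> 1" using g by (auto simp: \<delta>_def divide_le_eq)
  have \<epsilon>: "\<epsilon> = \<delta> / 4" by (simp add: \<epsilon>_def \<delta>_def)
  have \<delta>M: "\<delta> * real M = real g" using g by (simp add: \<delta>_def M_g power2_eq_square power3_eq_cube)
  have "\<delta> * \<delta> \<le> \<delta> * (4/5)"
  proof -
    have "(2::real) ^ 2 \<le> (real g)\<^sup>2" using g by (intro power_mono) auto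
    then have "\<delta> \<le> 4 / 5" by (simp add: \<delta>_def divide_le_eq)
    then show ?thesis using \<delta> by (intro mult_left_mono) auto
  qed
  moreover have "(1 + 5 * \<delta> / 8) * (1 + \<epsilon>) = 1 + 7 / 8 * \<delta> + 5 / 32 * (\<delta> * \<delta>)"
    by (simp add: \<epsilon> field_simps)
  ultimately have "(1 + 5 * \<delta> / 8) * (1 + \<epsilon>) \<le> 1 + \<delta>" by linarith
  then have "(1 + 5 * \<delta> / 8) * (1 + \<epsilon>) * real M \<le> (1 + \<delta>) * real M" by (intro mult_right_mono) auto
  also have "\<dots> \<le> real (Suc k) * (1 + \<epsilon>)" using assms by (simp add: \<delta>_def)
  finally have "((1 + 5 * \<delta> / 8) * real M) * (1 + \<epsilon>) \<le> real (Suc k) * (1 + \<epsilon>)" by (simp add: mult_ac)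
  then have "(1 + 5 * \<delta> / 8) * real M \<le> real (Suc k)"
    by (rule mult_right_le_imp_le) (use \<delta> in \<open>simp add: \<epsilon>\<close>)
  moreover have "(1 + 5 * \<delta> / 8) * real M = real M + 5 / 8 * real g" using \<delta>M by (simp add: algebra_simps)
  ultimately have "real M + 5 / 8 * real g \<le> real k + 1" by simp
  then have "real M + real g / 2 + 324 \<le> real k" using g by linarith
  moreover have "(1 + \<delta> / 2) * real M = real M + real g / 2" using \<delta>M by (simp add: algebra_simps)
  moreover have "1 / (2 * (real g)\<^sup>2) = \<delta> / 2" by (simp add: \<delta>_def)
  ultimately show ?thesis by (simp only:)
qed

text \<open>The exponent for which \<open>(1 + 1 / (2 g\<^sup>2)) M\<close> pieces of relative size \<open>1 / M\<close> balance one piece.\<close>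

definition \<kappa> :: real where "\<kappa> = 1 + ln (1 + 1 / (2 * (real g)\<^sup>2)) / ln (real M)"

lemma \<kappa>_gt_1: "\<kappa> > 1"
proof -
  have "real g > 0" "real M > 1" using g_ge M_ge by auto
  then show ?thesis by (simp add: \<kappa>_def ln_gt_zero)
qed

lemma M_powr_\<kappa>: "real M powr \<kappa> = (1 + 1 / (2 * (real g)\<^sup>2)) * real M"
proof -
  have "real g > 0" "real M > 1" using g_ge M_ge by auto
  moreover have "1 + 1 / (2 * (real g)\<^sup>2) > 0" by (simp add: add_pos_nonneg)
  ultimately show ?thesis by (simp add: \<kappa>_def powr_add) (simp add: powr_def)
qed

text \<open>The confinement to a ball around the start keeps the starts of all subpieces among the
  children of the starting cell.\<close>

definition piece :: "(real \<Rightarrow> real \<times> real) \<Rightarrow> nat \<Rightarrow> real \<Rightarrow> real \<Rightarrow> bool" where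
  "piece f n s t \<longleftrightarrow> s \<in> {0..1} \<and> t \<in> {0..1} \<and> s \<le> t \<and> dist (f s) (f t) = 1 / real M ^ n \<and>
     (\<forall>u\<in>{s..t}. dist (f s) (f u) \<le> 1 / real M ^ n)"

text \<open>The starts of the subpieces form a chain with steps of length
  \<open>(1 + \<epsilon>) / M ^ Suc n\<close>. A cell that is not straight forces a detour of this
  chain, so the chain needs many steps.\<close>

lemma piece_subdivision:
  assumes cont: "continuous_on {0..1} f" and lim: "f ` {0..1} \<subseteq> perc_limit N \<omega>"
    and pc: "piece f n s t"
    and ns: "\<not> straight n (ix n (fst (f s))) (ix n (snd (f s))) \<omega>"
  obtains k \<sigma> \<tau> where "(1 + 1 / (2 * (real g)\<^sup>2)) * real M + 324 \<le> real k"
    and "\<And>i. i < k \<Longrightarrow> piece f (Suc n) (\<sigma> i) (\<tau> i) \<and> s \<le> \<sigma> i \<and> \<tau> i \<le> t"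
    and "\<And>i i' u u'. i < i' \<Longrightarrow> i' < k \<Longrightarrow> u \<in> {\<sigma> i..\<tau> i} \<Longrightarrow> u' \<in> {\<sigma> i'..\<tau> i'} \<Longrightarrow>
       \<epsilon> / real M ^ Suc n \<le> dist (f u) (f u')"
    and "\<And>i i'. i < i' \<Longrightarrow> i' < k \<Longrightarrow> 1 / real M ^ Suc n \<le> dist (f (\<sigma> i)) (f (\<sigma> i'))"
proof -
  define l where "l = 1 / real M ^ Suc n"
  define r where "r = (1 + \<epsilon>) * l"
  have M0: "real M > 0" "real M ^ n > 0" using M_ge by auto
  have l: "0 < l" using M0 by (simp add: l_def)
  have g: "real g \<ge> 2600" using g_large by (simp add: g_def flip: of_nat_power)
  have "1 \<le> (real g)\<^sup>2" using g by (intro one_le_power) auto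
  then have "1 \<le> 4 * (real g)\<^sup>2" by linarith
  then have \<epsilon>: "0 < \<epsilon>" "\<epsilon> \<le> 1" unfolding \<epsilon>_def
    by (simp_all only: divide_le_eq_1_pos zero_less_divide_1_iff)
  have lr: "l < r" "r - l = \<epsilon> * l" "r \<le> 2 * l" using l \<epsilon> by (auto simp: r_def algebra_simps)
  have st: "s \<le> t" "{s..t} \<subseteq> {0..1}" using pc by (auto simp: piece_def)
  have cst: "continuous_on {s..t} f" using cont st(2) by (rule continuous_on_subset)
  show ?thesis
  proof (rule separated_pieces[OF st(1) cst l lr(1)])
    fix k \<sigma> \<tau>
    assume \<sigma>0: "\<sigma> 0 = s" and \<sigma>: "\<And>i. i \<le> k \<Longrightarrow> \<sigma> i \<in> {s..t}"
    and pcs: "\<And>i. i < k \<Longrightarrow> \<sigma> i \<le> \<tau> i \<and> \<tau> i \<le> t \<and> dist (f (\<sigma> i)) (f (\<tau> i)) = l \<and>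
        (\<forall>u\<in>{\<sigma> i..\<tau> i}. dist (f (\<sigma> i)) (f u) \<le> l)"
    and steps: "\<And>i. i < k \<Longrightarrow> dist (f (\<sigma> i)) (f (\<sigma> (Suc i))) = r"
    and sep: "\<And>i i' u u'. i < i' \<Longrightarrow> i' < k \<Longrightarrow> u \<in> {\<sigma> i..\<tau> i} \<Longrightarrow> u' \<in> {\<sigma> i'..\<tau> i'} \<Longrightarrow>
        r - l \<le> dist (f u) (f u')"
    and sep': "\<And>i i'. i < i' \<Longrightarrow> i' \<le> k \<Longrightarrow> r \<le> dist (f (\<sigma> i)) (f (\<sigma> i'))"
    and last: "dist (f (\<sigma> k)) (f t) < r"
    \<comment> \<open>The end point is appended, with a last step shorter than \<open>r\<close>;
      this makes \<open>Suc k\<close> steps but only \<open>k\<close> subpieces.\<close>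
    define z where "z = (\<lambda>i. f (if i \<le> k then \<sigma> i else t))"
    have z0: "z 0 = f s" "z (Suc k) = f t" by (auto simp: z_def \<sigma>0)
    have zstep: "dist (z i) (z (Suc i)) \<le> r" if "i < Suc k" for i
    proof (cases "i < k")
      case True
      then show ?thesis using steps[OF True] by (simp add: z_def)
    next
      case False
      then have "i = k" using that by simp
      then show ?thesis using last by (simp add: z_def)
    qed
    \<comment> \<open>The steps must not exceed the side \<open>1 / (g * M ^ n)\<close> of the
      squares that \<open>straight\<close> inspects; \<open>2 g \<le> g^3\<close> suffices.\<close>
    have "2 * l \<le> 1 / (real g * real M ^ n)"
    proof -
      have "2 * real g \<le> real M"
      proof -
        have "2 \<le> g" using g_ge by simp
        also have "g \<le> g\<^sup>2" unfolding power2_eq_square by (rule le_square)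
        finally have "2 \<le> g\<^sup>2" .
        then have "2 * g \<le> g\<^sup>2 * g" by (rule mult_le_mono1)
        also have "g\<^sup>2 * g = M" by (simp add: M_g power3_eq_cube power2_eq_square)
        finally show ?thesis by linarith
      qed
      then have "2 * real g * real M ^ n \<le> real M * real M ^ n" using M0 by (intro mult_right_mono) auto
      then show ?thesis using M0 g by (simp add: l_def field_simps)
    qed
    then have zs: "dist (z i) (z (Suc i)) \<le> 1 / (real g * real M ^ n)" if "i < Suc k" for i
      using zstep[OF that] lr by linarith
    have zlim: "z i \<in> perc_limit N \<omega>" if "i \<le> Suc k" for i
      using lim \<sigma>[of i] st pc that by (auto simp: z_def piece_def intro!: imageI subsetD[OF lim])
    have "\<exists>i\<le>Suc k. (1 + 1 / (real g)\<^sup>2) / real M ^ n \<le> dist (z 0) (z i) + dist (z i) (z (Suc k))"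
      by (rule not_straight_detour[where z = z and k = "Suc k", OF zlim zs]) (use pc ns in \<open>auto simp: z0 piece_def ix_def\<close>)
    then obtain i where i: "i \<le> Suc k" "(1 + 1 / (real g)\<^sup>2) / real M ^ n \<le> dist (z 0) (z i) + dist (z i) (z (Suc k))"
      by blast
    note i(2)
    also have "dist (z 0) (z i) + dist (z i) (z (Suc k)) \<le> real (i - 0) * r + real (Suc k - i) * r"
      using i(1) by (intro add_mono dist_chain_le[where z = z and k = "Suc k", OF zstep]) auto
    also have "\<dots> = real (Suc k) * r" using i(1) by (simp add: of_nat_diff algebra_simps)
    finally have "(1 + 1 / (real g)\<^sup>2) / real M ^ n \<le> real (Suc k) * (1 + \<epsilon>) / (real M * real M ^ n)"
      by (simp add: r_def l_def)
    then have "(1 + 1 / (real g)\<^sup>2) / real M ^ n \<le> (real (Suc k) * (1 + \<epsilon>) / real M) / real M ^ n"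
      by (simp only: divide_divide_eq_left)
    then have "1 + 1 / (real g)\<^sup>2 \<le> real (Suc k) * (1 + \<epsilon>) / real M"
      by (metis M0(2) divide_le_cancel)
    then have "(1 + 1 / (real g)\<^sup>2) * real M \<le> real (Suc k) * (1 + \<epsilon>)"
      using M0(1) by (simp only: pos_le_divide_eq)
    from piece_count[OF this]
    have k: "(1 + 1 / (2 * (real g)\<^sup>2)) * real M + 324 \<le> real k" .
    have 1: "piece f (Suc n) (\<sigma> i) (\<tau> i) \<and> s \<le> \<sigma> i \<and> \<tau> i \<le> t" if "i < k" for i
      using pcs[OF that] \<sigma>[of i] that st unfolding piece_def l_def[symmetric] by auto
    have rl: "r - l = \<epsilon> / real M ^ Suc n" unfolding lr(2) by (simp add: l_def)
    have 2: "\<epsilon> / real M ^ Suc n \<le> dist (f u) (f u')"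
      if "i < i'" "i' < k" "u \<in> {\<sigma> i..\<tau> i}" "u' \<in> {\<sigma> i'..\<tau> i'}" for i i' u u'
      using sep[of i i' u u'] that unfolding rl by blast
    have 3: "1 / real M ^ Suc n \<le> dist (f (\<sigma> i)) (f (\<sigma> i'))" if "i < i'" "i' < k" for i i'
      using sep'[of i i'] that lr(1) unfolding l_def by simp
    show ?thesis by (rule that[OF k 1 2 3])
  qed
qed

text \<open>The gap \<open>\<epsilon> / M ^ Suc n\<close> between the subpieces of a piece of scale
  \<open>n\<close> equals \<open>\<eta> / M ^ n\<close>.\<close>

definition \<eta> :: real where "\<eta> = \<epsilon> / real M"

lemma \<eta>_pos: "\<eta> > 0" using g_ge M_ge by (simp add: \<eta>_def \<epsilon>_def)

text \<open>A set of size at least \<open>\<eta> / M ^ n\<close> pays for the whole piece. Otherwise every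
  set of the cover meets at most one of the separated subpieces, and the costs of the good subpieces add up.\<close>

lemma good_piece_cover:
  fixes U :: "'i \<Rightarrow> (real \<times> real) set" and d :: "'i \<Rightarrow> real"
  assumes cont: "continuous_on {0..1} f" and lim: "f ` {0..1} \<subseteq> perc_limit N \<omega>"
    and fin: "finite F" and cover: "f ` {0..1} \<subseteq> (\<Union>i\<in>F. U i)"
    and d: "\<And>i x y. i \<in> F \<Longrightarrow> x \<in> U i \<Longrightarrow> y \<in> U i \<Longrightarrow> dist x y \<le> d i"
  shows "piece f n s t \<Longrightarrow> \<not> bad j n (ix n (fst (f s))) (ix n (snd (f s))) \<omega> \<Longrightarrow>
    (\<And>i. i \<in> F \<Longrightarrow> \<eta> / real M ^ (n + j) \<le> d i) \<Longrightarrow>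
    (\<eta> / real M ^ n) powr \<kappa> \<le> (\<Sum>i\<in>{i \<in> F. U i \<inter> f ` {s..t} \<noteq> {}}. d i powr \<kappa>)"
proof (induction j arbitrary: n s t)
  \<comment> \<open>The number \<open>j\<close> also counts the scales down to the smallest set of
    the cover. For \<open>j = 0\<close> all sets have size at least \<open>\<eta> / M ^ n\<close>,
    and one that contains \<open>f s\<close> suffices.\<close>
  case 0
  have \<kappa>0: "\<kappa> \<ge> 0" using \<kappa>_gt_1 by simp
  have st: "s \<in> {0..1}" "s \<le> t" using "0.prems" by (auto simp: piece_def)
  then obtain i where i: "i \<in> F" "f s \<in> U i" using cover by blast
  have "(\<eta> / real M ^ n) powr \<kappa> \<le> d i powr \<kappa>"
    using "0.prems"(3)[OF i(1)] \<eta>_pos M_ge \<kappa>0 by (intro powr_mono2) auto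
  also have "\<dots> \<le> (\<Sum>i\<in>{i \<in> F. U i \<inter> f ` {s..t} \<noteq> {}}. d i powr \<kappa>)"
    using i st fin by (intro member_le_sum) auto
  finally show ?case .
next
  case (Suc j)
  have \<kappa>0: "\<kappa> \<ge> 0" using \<kappa>_gt_1 by simp
  have M0: "real M > 0" "real M ^ n > 0" using M_ge by auto
  define H where "H = (\<lambda>s t. {i \<in> F. U i \<inter> f ` {s..t} \<noteq> {}})"
  have finH: "finite (H s t)" for s t using fin by (simp add: H_def)
  show ?case
  proof (cases "\<exists>i\<in>H s t. \<eta> / real M ^ n \<le> d i")
    case True
    then obtain i where i: "i \<in> H s t" "\<eta> / real M ^ n \<le> d i" by blast
    have "(\<eta> / real M ^ n) powr \<kappa> \<le> d i powr \<kappa>"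
      using i(2) \<eta>_pos M0 \<kappa>0 by (intro powr_mono2) auto
    also have "\<dots> \<le> (\<Sum>i\<in>H s t. d i powr \<kappa>)"
      using i(1) finH by (intro member_le_sum) auto
    finally show ?thesis by (simp add: H_def)
  next
    case False
    let ?a = "ix n (fst (f s))" and ?b = "ix n (snd (f s))"
    have ns: "\<not> straight n ?a ?b \<omega>" and ntf: "\<not> two_far (bad j (Suc n)) ?a ?b \<omega>"
      using Suc.prems(2) by auto
    show ?thesis
    proof (rule piece_subdivision[OF cont lim Suc.prems(1) ns])
      fix k \<sigma> \<tau>
      assume k: "(1 + 1 / (2 * (real g)\<^sup>2)) * real M + 324 \<le> real k"
      and pcs: "\<And>i. i < k \<Longrightarrow> piece f (Suc n) (\<sigma> i) (\<tau> i) \<and> s \<le> \<sigma> i \<and> \<tau> i \<le> t"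
      and sep: "\<And>i i' u u'. i < i' \<Longrightarrow> i' < k \<Longrightarrow> u \<in> {\<sigma> i..\<tau> i} \<Longrightarrow> u' \<in> {\<sigma> i'..\<tau> i'} \<Longrightarrow>
         \<epsilon> / real M ^ Suc n \<le> dist (f u) (f u')"
      and sep': "\<And>i i'. i < i' \<Longrightarrow> i' < k \<Longrightarrow> 1 / real M ^ Suc n \<le> dist (f (\<sigma> i)) (f (\<sigma> i'))"
      define Ba where "Ba = {i \<in> {..<k}. bad j (Suc n) (ix (Suc n) (fst (f (\<sigma> i)))) (ix (Suc n) (snd (f (\<sigma> i)))) \<omega>}"
      define Go where "Go = {..<k} - Ba"
      have fB: "finite Ba" "Ba \<subseteq> {..<k}" and fG: "finite Go" by (auto simp: Ba_def Go_def)
      have ch: "ix (Suc n) (fst (f (\<sigma> i))) \<in> children ?a" "ix (Suc n) (snd (f (\<sigma> i))) \<in> children ?b" if "i < k" for i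
      proof -
        have "\<sigma> i \<in> {s..t}" using pcs[OF that] by (auto simp: piece_def)
        then have "dist (f s) (f (\<sigma> i)) \<le> 1 / real M ^ n" using Suc.prems(1) by (auto simp: piece_def)
        from children_of_close_point[OF this]
        show "ix (Suc n) (fst (f (\<sigma> i))) \<in> children ?a" "ix (Suc n) (snd (f (\<sigma> i))) \<in> children ?b" .
      qed
      \<comment> \<open>Bad starts in cells more than 4 apart would make the cell of
        \<open>f s\<close> bad through \<open>two_far\<close>.\<close>
      have "card Ba \<le> 324"
      proof (rule card_bad_points_le[OF fB(1), of "Suc n" "\<lambda>i. f (\<sigma> i)"])
        fix i i' assume "i \<in> Ba" "i' \<in> Ba"
        then have ii: "i < k" "i' < k" and "bad j (Suc n) (ix (Suc n) (fst (f (\<sigma> i)))) (ix (Suc n) (snd (f (\<sigma> i)))) \<omega>"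
          "bad j (Suc n) (ix (Suc n) (fst (f (\<sigma> i')))) (ix (Suc n) (snd (f (\<sigma> i')))) \<omega>"
          by (auto simp: Ba_def)
        then show "\<bar>ix (Suc n) (fst (f (\<sigma> i))) - ix (Suc n) (fst (f (\<sigma> i')))\<bar> \<le> 4 \<and>
          \<bar>ix (Suc n) (snd (f (\<sigma> i))) - ix (Suc n) (snd (f (\<sigma> i')))\<bar> \<le> 4"
          using ntf two_farI[of _ ?a _ ?b _ _ "bad j (Suc n)", OF ch[OF ii(1)] ch[OF ii(2)]] by (meson not_le)
      qed (use sep' in \<open>auto simp: Ba_def\<close>)
      moreover have "card Go = k - card Ba" using fB by (simp add: Go_def card_Diff_subset)
      ultimately have Go: "real M powr \<kappa> \<le> real (card Go)"
        using k card_mono[OF _ fB(2)] by (simp add: M_powr_\<kappa> of_nat_diff)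
      \<comment> \<open>A set meeting two subpieces is at least as large as their gap
        \<open>\<eta> / M ^ n\<close>, a case already settled.\<close>
      have disj: "H (\<sigma> i) (\<tau> i) \<inter> H (\<sigma> i') (\<tau> i') = {}" if "i < i'" "i' < k" for i i'
      proof (rule ccontr)
        assume "\<not> ?thesis"
        then obtain q u u' where q: "q \<in> F" "u \<in> {\<sigma> i..\<tau> i}" "f u \<in> U q" "u' \<in> {\<sigma> i'..\<tau> i'}" "f u' \<in> U q"
          unfolding H_def by blast
        have "\<epsilon> / real M ^ Suc n \<le> d q"
          using sep[OF that q(2,4)] d[OF q(1,3,5)] by simp
        moreover have "q \<in> H s t"
        proof -
          have "u \<in> {s..t}" using q(2) pcs[of i] that by auto
          then show ?thesis using q(1,3) by (auto simp: H_def)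
        qed
        ultimately show False using False M0 by (force simp: \<eta>_def)
      qed
      have sub: "(\<Union>i\<in>Go. H (\<sigma> i) (\<tau> i)) \<subseteq> H s t"
      proof
        fix q assume "q \<in> (\<Union>i\<in>Go. H (\<sigma> i) (\<tau> i))"
        then obtain i where i: "i < k" "q \<in> H (\<sigma> i) (\<tau> i)" by (auto simp: Go_def)
        have "f ` {\<sigma> i..\<tau> i} \<subseteq> f ` {s..t}" using pcs[OF i(1)] by (intro image_mono) auto
        then show "q \<in> H s t" using i(2) by (auto simp: H_def)
      qed
      \<comment> \<open>Going down one scale divides the weight by \<open>M powr \<kappa>\<close>,
        and at least that many subpieces are good.\<close>
      have "(\<eta> / real M ^ n) powr \<kappa> = real M powr \<kappa> * (\<eta> / real M ^ Suc n) powr \<kappa>"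
        using M0 \<eta>_pos by (subst powr_mult[symmetric]) auto
      also have "\<dots> \<le> real (card Go) * (\<eta> / real M ^ Suc n) powr \<kappa>"
        using Go by (intro mult_right_mono) auto
      also have "\<dots> = (\<Sum>i\<in>Go. (\<eta> / real M ^ Suc n) powr \<kappa>)" by simp
      also have "\<dots> \<le> (\<Sum>i\<in>Go. \<Sum>q\<in>H (\<sigma> i) (\<tau> i). d q powr \<kappa>)"
      proof (rule sum_mono)
        fix i assume "i \<in> Go"
        then have "i < k" "\<not> bad j (Suc n) (ix (Suc n) (fst (f (\<sigma> i)))) (ix (Suc n) (snd (f (\<sigma> i)))) \<omega>"
          by (auto simp: Go_def Ba_def)
        then show "(\<eta> / real M ^ Suc n) powr \<kappa> \<le> (\<Sum>q\<in>H (\<sigma> i) (\<tau> i). d q powr \<kappa>)"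
          unfolding H_def using Suc.IH[of "Suc n" "\<sigma> i" "\<tau> i"] pcs[of i] Suc.prems(3) by simp
      qed
      also have "\<dots> = (\<Sum>q\<in>(\<Union>i\<in>Go. H (\<sigma> i) (\<tau> i)). d q powr \<kappa>)"
      proof (rule sum.UNION_disjoint[symmetric, OF fG])
        show "\<forall>i\<in>Go. \<forall>i'\<in>Go. i \<noteq> i' \<longrightarrow> H (\<sigma> i) (\<tau> i) \<inter> H (\<sigma> i') (\<tau> i') = {}"
          using disj by (auto simp: Go_def) (metis IntI empty_iff linorder_neqE_nat)
      qed (simp add: finH)
      also have "\<dots> \<le> (\<Sum>q\<in>H s t. d q powr \<kappa>)"
        using sub finH by (intro sum_mono2) auto
      finally show "(\<eta> / real M ^ n) powr \<kappa> \<le> (\<Sum>i\<in>{i \<in> F. U i \<inter> f ` {s..t} \<noteq> {}}. d i powr \<kappa>)"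
        by (simp add: H_def)
    qed
  qed
qed

end

section \<open>Hausdorff dimension\<close>

lemma powr_enlarge:
  fixes D \<kappa> e :: real
  assumes "D \<ge> 0" "\<kappa> > 0" "e > 0"
  shows "\<exists>\<zeta>>0. (D + 2 * \<zeta>) powr \<kappa> \<le> D powr \<kappa> + e"
proof -
  have "((\<lambda>\<zeta>. (D + 2 * \<zeta>) powr \<kappa>) \<longlongrightarrow> (D + 2 * 0) powr \<kappa>) (at_right 0)"
    using assms by (intro tendsto_powr' tendsto_intros) (auto simp: eventually_at_filter)
  then have "\<forall>\<^sub>F \<zeta> in at_right 0. (D + 2 * \<zeta>) powr \<kappa> < D powr \<kappa> + e"
    by (rule order_tendstoD) (use assms in auto)
  moreover have "\<forall>\<^sub>F \<zeta> in at_right 0. \<zeta> > (0::real)" by (simp add: eventually_at_right_less)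
  ultimately have "\<forall>\<^sub>F \<zeta> in at_right 0. \<zeta> > 0 \<and> (D + 2 * \<zeta>) powr \<kappa> \<le> D powr \<kappa> + e"
    by eventually_elim auto
  then show ?thesis using eventually_happens'[OF trivial_limit_at_right_real] by blast
qed

lemma diam_power_ge:
  assumes "0 \<le> s" "s \<le> \<kappa>" "0 < \<kappa>" "U \<noteq> {}" "bounded U" "diameter U \<le> 1"
  shows "ennreal (diameter U powr \<kappa>) \<le> diam_power s U"
proof -
  have D: "0 \<le> diameter U" using assms by (intro diameter_ge_0)
  have "diameter U powr \<kappa> \<le> diameter U powr s" if "s \<noteq> 0"
  proof (cases "diameter U = 0")
    case False
    then show ?thesis using D assms by (intro powr_mono') auto
  qed simp
  moreover have "diameter U powr \<kappa> \<le> 1" using D assms by (intro powr_le1) auto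
  ultimately show ?thesis using assms by (auto simp: diam_power_def intro: ennreal_leI)
qed

text \<open>Every set of a countable cover is fattened to an open one, and compactness selects a
  finite subcover. The extra costs \<open>C / 4 * (1 / 2) ^ i\<close> sum to \<open>C / 2\<close>,
  so half of the bound survives. Covers by sets of diameter at most 1 suffice, and for them an
  exponent below \<open>\<kappa>\<close> only raises the cost.\<close>

lemma hausdorff_dim_ge_of_finite_covers:
  fixes A :: "'a::metric_space set"
  assumes A: "compact A" and C: "C > 0" and \<kappa>: "\<kappa> > 0"
    and cov: "\<And>(F :: nat set) V d. finite F \<Longrightarrow> A \<subseteq> (\<Union>i\<in>F. V i) \<Longrightarrow> (\<And>i. i \<in> F \<Longrightarrow> d i > 0) \<Longrightarrow>
      (\<And>i x y. i \<in> F \<Longrightarrow> x \<in> V i \<Longrightarrow> y \<in> V i \<Longrightarrow> dist x y \<le> d i) \<Longrightarrow>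
      C \<le> (\<Sum>i\<in>{i \<in> F. V i \<noteq> {}}. d i powr \<kappa>)"
  shows "ennreal \<kappa> \<le> hausdorff_dim A"
  unfolding hausdorff_dim_def
proof (rule Inf_greatest)
  fix h assume "h \<in> {ennreal s | s. 0 \<le> s \<and> hausdorff_measure s A = 0}"
  then obtain s where s: "h = ennreal s" "0 \<le> s" "hausdorff_measure s A = 0" by auto
  have "\<kappa> \<le> s"
  proof (rule ccontr)
    assume "\<not> \<kappa> \<le> s"
    then have s\<kappa>: "s \<le> \<kappa>" by simp
    have "ennreal (C / 2) \<le> hausdorff_content s 1 A"
      unfolding hausdorff_content_def
    proof (rule INF_greatest)
      fix U :: "nat \<Rightarrow> 'a set"
      assume "U \<in> {U. A \<subseteq> (\<Union>i. U i) \<and> (\<forall>i. bounded (U i) \<and> diameter (U i) \<le> 1)}"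
      then have U: "A \<subseteq> (\<Union>i. U i)" "\<And>i. bounded (U i)" "\<And>i. diameter (U i) \<le> 1" by auto
      have "\<forall>i. \<exists>\<zeta>>0. (diameter (U i) + 2 * \<zeta>) powr \<kappa> \<le> diameter (U i) powr \<kappa> + C / 4 * (1 / 2) ^ i"
        using U(2) C \<kappa> by (intro allI powr_enlarge diameter_ge_0) auto
      then obtain \<zeta> where \<zeta>: "\<And>i. \<zeta> i > 0"
        "\<And>i. (diameter (U i) + 2 * \<zeta> i) powr \<kappa> \<le> diameter (U i) powr \<kappa> + C / 4 * (1 / 2) ^ i" by metis
      define V where "V = (\<lambda>i. \<Union>x\<in>U i. ball x (\<zeta> i))"
      define d where "d = (\<lambda>i. diameter (U i) + 2 * \<zeta> i)"
      have "A \<subseteq> (\<Union>i. V i)" using U(1) \<zeta>(1) by (force simp: V_def)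
      moreover have "open (V i)" for i by (auto simp: V_def)
      ultimately obtain F where F: "finite F" "A \<subseteq> (\<Union>i\<in>F. V i)"
        using compactE_image[OF A, of UNIV V] by (metis subset_UNIV)
      have dV: "dist x y \<le> d i" if "x \<in> V i" "y \<in> V i" for i x y
      proof -
        obtain x' y' where *: "x' \<in> U i" "dist x' x < \<zeta> i" "y' \<in> U i" "dist y' y < \<zeta> i"
          using \<open>x \<in> V i\<close> \<open>y \<in> V i\<close> by (auto simp: V_def)
        have "dist x y \<le> dist x x' + dist x' y" by (rule dist_triangle)
        also have "dist x' y \<le> dist x' y' + dist y' y" by (rule dist_triangle)
        also have "dist x' y' \<le> diameter (U i)" using * U(2) by (intro diameter_bounded_bound)
        finally show ?thesis using * by (simp add: d_def dist_commute)
      qed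
      have d0: "d i > 0" for i using \<zeta>(1)[of i] diameter_ge_0[OF U(2), of i] by (simp add: d_def)
      \<comment> \<open>An empty set costs 0 in \<open>diam_power\<close>, whereas its
        \<open>d i\<close> is positive; such indices have to be left out.\<close>
      define G where "G = {i \<in> F. V i \<noteq> {}}"
      have finG: "finite G" using F(1) by (simp add: G_def)
      have G: "U i \<noteq> {}" if "i \<in> G" for i using that by (auto simp: G_def V_def)
      have "C \<le> (\<Sum>i\<in>G. d i powr \<kappa>)"
        unfolding G_def by (rule cov[OF F d0 dV])
      also have "\<dots> \<le> (\<Sum>i\<in>G. diameter (U i) powr \<kappa> + C / 4 * (1 / 2) ^ i)"
        using \<zeta>(2) by (intro sum_mono) (simp add: d_def)
      also have "\<dots> = (\<Sum>i\<in>G. diameter (U i) powr \<kappa>) + C / 4 * (\<Sum>i\<in>G. (1 / 2) ^ i)"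
        by (simp add: sum.distrib sum_distrib_left)
      also have "(\<Sum>i\<in>G. (1 / 2) ^ i) \<le> (\<Sum>i. (1 / 2 :: real) ^ i)"
        using finG by (intro sum_le_suminf) (auto intro: summable_geometric)
      also have "\<dots> = 2" by (simp add: suminf_geometric)
      finally have "C / 2 \<le> (\<Sum>i\<in>G. diameter (U i) powr \<kappa>)" using C by (simp add: mult_left_mono)
      then have "ennreal (C / 2) \<le> (\<Sum>i\<in>G. ennreal (diameter (U i) powr \<kappa>))"
        by (subst sum_ennreal) (auto intro: ennreal_leI)
      also have "\<dots> \<le> (\<Sum>i\<in>G. diam_power s (U i))"
        using G U s(2) s\<kappa> \<kappa> by (intro sum_mono diam_power_ge) auto
      also have "\<dots> \<le> (\<Sum>i. diam_power s (U i))"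
        using finG by (intro sum_le_suminf) auto
      finally show "ennreal (C / 2) \<le> (\<Sum>i. diam_power s (U i))" .
    qed
    also have "\<dots> \<le> hausdorff_measure s A"
      unfolding hausdorff_measure_def by (rule SUP_upper) simp
    finally show False using s(3) C by simp
  qed
  then show "ennreal \<kappa> \<le> h" using s by (simp add: ennreal_leI)
qed

context renormalization
begin

section \<open>Almost surely every nonconstant path contains a good piece\<close>

lemma good_piece_dim:
  assumes cont: "continuous_on {0..1} f" and lim: "f ` {0..1} \<subseteq> perc_limit N \<omega>"
    and pc: "piece f n s t" and good: "\<And>j. \<not> bad j n (ix n (fst (f s))) (ix n (snd (f s))) \<omega>"
  shows "ennreal \<kappa> \<le> hausdorff_dim (f ` {0..1})"
proof (rule hausdorff_dim_ge_of_finite_covers[where C = "(\<eta> / real M ^ n) powr \<kappa>"])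
  have M0: "real M > 1" "real M ^ n > 0" using M_ge by auto
  show "compact (f ` {0..1})" using cont by (intro compact_continuous_image) auto
  show "0 < (\<eta> / real M ^ n) powr \<kappa>" using \<eta>_pos M0 by simp
  show "0 < \<kappa>" using \<kappa>_gt_1 by simp
  fix F :: "nat set" and V d
  assume F: "finite F" "f ` {0..1} \<subseteq> (\<Union>i\<in>F. V i)" and d0: "\<And>i. i \<in> F \<Longrightarrow> d i > 0"
    and d: "\<And>i x y. i \<in> F \<Longrightarrow> x \<in> V i \<Longrightarrow> y \<in> V i \<Longrightarrow> dist x y \<le> d i"
  \<comment> \<open>Since the cell is bad for no \<open>j\<close>, the depth may be chosen after the
    finite cover.\<close>
  have "(\<lambda>j. \<eta> * (1 / real M) ^ (n + j)) \<longlonglongrightarrow> \<eta> * 0"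
    using M0 by (intro tendsto_mult_left LIMSEQ_ignore_initial_segment[where k = n, unfolded add.commute[of _ n]]
        LIMSEQ_realpow_zero) auto
  then have "\<forall>\<^sub>F j in sequentially. \<eta> * (1 / real M) ^ (n + j) < d i" if "i \<in> F" for i
    using d0[OF that] by (intro order_tendstoD) auto
  then have "\<forall>\<^sub>F j in sequentially. \<forall>i\<in>F. \<eta> * (1 / real M) ^ (n + j) < d i"
    using F(1) by (simp add: eventually_ball_finite)
  then obtain j where j: "\<And>i. i \<in> F \<Longrightarrow> \<eta> * (1 / real M) ^ (n + j) < d i"
    by (auto simp: eventually_sequentially)
  have j': "\<eta> / real M ^ (n + j) \<le> d i" if "i \<in> F" for i
    using j[OF that] by (simp add: power_one_over)
  have "(\<eta> / real M ^ n) powr \<kappa> \<le> (\<Sum>i\<in>{i \<in> F. V i \<inter> f ` {s..t} \<noteq> {}}. d i powr \<kappa>)"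
    by (rule good_piece_cover[where U = V and d = d, OF cont lim F d pc good j'])
  also have "\<dots> \<le> (\<Sum>i\<in>{i \<in> F. V i \<noteq> {}}. d i powr \<kappa>)"
    using F(1) by (intro sum_mono2) auto
  finally show "(\<eta> / real M ^ n) powr \<kappa> \<le> (\<Sum>i\<in>{i \<in> F. V i \<noteq> {}}. d i powr \<kappa>)" .
qed

lemma piece_exists:
  assumes "continuous_on {0..1} f" "u \<in> {0..1}" "v \<in> {0..1}" "u \<le> v" "1 / real M ^ n \<le> dist (f u) (f v)"
  shows "\<exists>t\<in>{u..v}. piece f n u t"
proof -
  have "continuous_on {u..v} (\<lambda>x. dist (f u) (f x))"
    using assms by (intro continuous_intros continuous_on_subset[OF assms(1)]) auto
  from first_hit[OF assms(4) this, of "1 / real M ^ n"] assms obtain t where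
    "t \<in> {u..v}" "dist (f u) (f t) = 1 / real M ^ n" "\<forall>x\<in>{u..t}. dist (f u) (f x) \<le> 1 / real M ^ n"
    by auto
  then show ?thesis using assms by (intro bexI[of _ t]) (auto simp: piece_def)
qed

text \<open>A piece contains two subpieces whose starts are half its length apart, hence in distant
  cells. If both cells were very bad at level \<open>i\<close>, the parent would be so at level
  \<open>Suc i\<close>. One of them can therefore be followed, and after \<open>i\<close> scales
  \<open>very_bad\<close> has become \<open>bad\<close>.\<close>

lemma good_piece_exists:
  assumes cont: "continuous_on {0..1} f"
  shows "piece f n s t \<Longrightarrow> (\<And>j. \<not> very_bad i j n (ix n (fst (f s))) (ix n (snd (f s))) \<omega>) \<Longrightarrow>
    \<exists>n s t. piece f n s t \<and> (\<forall>j. \<not> bad j n (ix n (fst (f s))) (ix n (snd (f s))) \<omega>)"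
proof (induction i arbitrary: n s t)
  case 0
  then show ?case by auto
next
  case (Suc i)
  define h where "h = 1 / real M ^ n"
  have M0: "real M \<ge> 40" "real M ^ n > 0" using M_ge by auto
  have h: "h > 0" "1 / real M ^ Suc n = h / real M" using M0 by (auto simp: h_def)
  have hM: "h / real M \<le> h / 2" using h M0 by (intro divide_left_mono) auto
  have st: "s \<in> {0..1}" "t \<in> {0..1}" "s \<le> t" "dist (f s) (f t) = h"
    "\<And>u. u \<in> {s..t} \<Longrightarrow> dist (f s) (f u) \<le> h" using Suc.prems(1) by (auto simp: piece_def h_def)
  have "continuous_on {s..t} (\<lambda>x. dist (f s) (f x))"
    using st by (intro continuous_intros continuous_on_subset[OF cont]) auto
  from first_hit[OF st(3) this, of "h / 2"] st h obtain v where v: "v \<in> {s..t}" "dist (f s) (f v) = h / 2"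
    by auto
  have "h \<le> h / 2 + dist (f v) (f t)" using dist_triangle[of "f s" "f t" "f v"] v st by simp
  then obtain t2 where t2: "piece f (Suc n) v t2"
    using piece_exists[OF cont, of v t "Suc n"] v(1) st hM unfolding h(2) by auto
  obtain t1 where t1: "piece f (Suc n) s t1"
    using piece_exists[OF cont, of s t "Suc n"] st hM h(1) unfolding h(2) by auto
  let ?B = "\<lambda>u j. very_bad i j (Suc n) (ix (Suc n) (fst (f u))) (ix (Suc n) (snd (f u))) \<omega>"
  show ?case
  proof (cases "(\<exists>j. ?B s j) \<and> (\<exists>j. ?B v j)")
    case False
    then show ?thesis using Suc.IH[OF t1] Suc.IH[OF t2] by blast
  next
    case True
    then obtain j1 j2 where "?B s j1" "?B v j2" by blast
    then have B: "?B s (max j1 j2)" "?B v (max j1 j2)" 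
    using very_bad_mono[OF max.cobounded1[of j1 j2]] very_bad_mono[OF max.cobounded2[of j2 j1]] by blast+
    \<comment> \<open>A distance of \<open>h / 4\<close> spans \<open>M / 4 \<ge> 10\<close> cells
      of scale \<open>Suc n\<close>.\<close>
    have far: "\<bar>ix (Suc n) x - ix (Suc n) y\<bar> > 4" if "\<bar>x - y\<bar> \<ge> h / 4" for x y
    proof -
      have "10 \<le> h / 4 * real M ^ Suc n" using M0 by (simp add: h_def)
      also have "\<dots> \<le> \<bar>x - y\<bar> * real M ^ Suc n" using that by (intro mult_right_mono) auto
      also have "\<dots> = \<bar>x * real M ^ Suc n - y * real M ^ Suc n\<bar>"
        by (simp add: abs_mult left_diff_distrib[symmetric])
      finally show ?thesis unfolding ix_def by linarith
    qed
    have "h / 4 \<le> \<bar>fst (f s) - fst (f v)\<bar> \<or> h / 4 \<le> \<bar>snd (f s) - snd (f v)\<bar>"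
      using dist_le_coord_sum[of "f s" "f v"] v(2) by linarith
    then have *: "\<bar>ix (Suc n) (fst (f s)) - ix (Suc n) (fst (f v))\<bar> > 4 \<or>
       \<bar>ix (Suc n) (snd (f s)) - ix (Suc n) (snd (f v))\<bar> > 4"
      using far by blast
    have "dist (f s) (f s) \<le> h" "dist (f s) (f v) \<le> h" using h(1) v(2) by auto
    note c = this[unfolded h_def, THEN children_of_close_point(1)] this[unfolded h_def, THEN children_of_close_point(2)]
    have "two_far (very_bad i (max j1 j2) (Suc n)) (ix n (fst (f s))) (ix n (snd (f s))) \<omega>"
      by (rule two_farI[where B = "very_bad i (max j1 j2) (Suc n)", OF c(1,3,2,4) * B])
    then show ?thesis using Suc.prems(2)[of "max j1 j2"] by simp
  qed
qed

lemma path_dim: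
  fixes f :: "real \<Rightarrow> real \<times> real"
  assumes cont: "continuous_on {0..1} f" and lim: "f ` {0..1} \<subseteq> perc_limit N \<omega>"
    and box: "f ` {0..1} \<subseteq> {0..1} \<times> {0..1}" and nc: "u \<in> {0..1}" "v \<in> {0..1}" "f u \<noteq> f v"
    and good: "\<And>n. \<exists>i. \<forall>j. \<forall>a\<in>{0..int (M ^ n)}. \<forall>b\<in>{0..int (M ^ n)}. \<not> very_bad i j n a b \<omega>"
  shows "ennreal \<kappa> \<le> hausdorff_dim (f ` {0..1})"
proof -
  have M0: "real M > 1" using M_ge by simp
  define u' where "u' = min u v"
  define v' where "v' = max u v"
  have uv: "u' \<in> {0..1}" "v' \<in> {0..1}" "u' \<le> v'" "f u' \<noteq> f v'"
    using nc by (auto simp: u'_def v'_def min_def max_def)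
  obtain n where n: "(1 / real M) ^ n < dist (f u') (f v')"
    using real_arch_pow_inv[of "dist (f u') (f v')" "1 / real M"] uv(4) M0 by auto
  then have "1 / real M ^ n \<le> dist (f u') (f v')" by (simp add: power_one_over)
  from piece_exists[OF cont uv(1-3) this] obtain t where t: "piece f n u' t" by blast
  obtain i where i: "\<And>j a b. a\<in>{0..int (M ^ n)} \<Longrightarrow> b\<in>{0..int (M ^ n)} \<Longrightarrow> \<not> very_bad i j n a b \<omega>"
    using good[of n] by blast
  \<comment> \<open>The coordinate 1 has index \<open>M ^ n\<close>, one past the last cell in the
    unit square; hence the closed range in \<open>good\<close>.\<close>
  have ixb: "ix n x \<in> {0..int (M ^ n)}" if "x \<in> {0..1}" for x
  proof -
    have "x * real M ^ n \<le> 1 * real M ^ n" using that by (intro mult_right_mono) auto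
    then have "\<lfloor>x * real M ^ n\<rfloor> \<le> \<lfloor>real (M ^ n)\<rfloor>" by (intro floor_mono) simp
    also have "\<lfloor>real (M ^ n)\<rfloor> = int (M ^ n)" by (rule floor_of_nat)
    finally show ?thesis using that by (simp add: ix_def del: of_nat_power)
  qed
  have "f u' \<in> {0..1} \<times> {0..1}" using box uv(1) by blast
  then have "fst (f u') \<in> {0..1}" "snd (f u') \<in> {0..1}" by (auto simp: mem_Times_iff)
  from good_piece_exists[OF cont t i[OF ixb[OF this(1)] ixb[OF this(2)]]]
  show ?thesis using good_piece_dim[OF cont lim] by blast
qed

text \<open>For fixed \<open>n\<close> there are finitely many cells. The event \<open>W i\<close>
  that one of them is very bad at level \<open>i\<close> for some \<open>j\<close> is an increasing
  union over \<open>j\<close>, so it inherits the uniform bound, which tends to 0 with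
  \<open>i\<close>. Thus the intersection of all \<open>W i\<close> is null.\<close>

lemma AE_good:
  assumes small: "324 * real g ^ 12 * \<rho> \<le> 1"
  shows "AE \<omega> in perc_measure N p. \<forall>n. \<exists>i. \<forall>j. \<forall>a\<in>{0..int (M ^ n)}. \<forall>b\<in>{0..int (M ^ n)}.
    \<not> very_bad i j n a b \<omega>"
proof (subst AE_all_countable, rule allI)
  fix n
  interpret prob_space "perc_measure N p" by (rule prob_space_perc_measure)
  define T where "T = {0..int (M ^ n)} \<times> {0..int (M ^ n)}"
  define J where "J = (\<lambda>i j. \<Union>(a, b)\<in>T. region n (j + i) a b)"
  define Z where "Z = (\<lambda>i j \<omega>. \<exists>(a, b)\<in>T. very_bad i j n a b \<omega>)"
  define W where "W = (\<lambda>i. \<Union>j. {\<omega> \<in> space (perc_measure N p). Z i j \<omega>})"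
  define c where "c = real (card T) / (81 * real g ^ 12)"
  have fT: "finite T" by (simp add: T_def)
  have fJ: "finite (J i j)" for i j using fT finite_region by (auto simp: J_def)
  have g0: "81 * real g ^ 12 > 0" using g_ge by simp
  have dep: "depends_on N (J i j) (\<lambda>\<omega>. case x of (a, b) \<Rightarrow> very_bad i j n a b \<omega>)" if "x \<in> T" for i j x
  proof -
    obtain a b where x: "x = (a, b)" by fastforce
    have "region n (j + i) a b \<subseteq> J i j" using that x by (auto simp: J_def)
    from depends_on_mono[OF depends_on_very_bad this] show ?thesis by (simp add: x)
  qed
  have Zs: "{\<omega> \<in> space (perc_measure N p). Z i j \<omega>} \<in> events" for i j
    unfolding Z_def by (rule depends_on_sets[OF depends_on_bex[OF dep] fJ])
  have Zp: "prb N p (Z i j) \<le> c * (1 / 2) ^ (2 ^ i)" for i j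
  proof -
    have "prb N p (very_bad i j n a b) \<le> (1 / 2) ^ (2 ^ i) / (81 * real g ^ 12)" for a b
      using prob_very_bad_le[OF small, of i j n a b] g0 by (simp add: pos_le_divide_eq mult.commute)
    then have "prb N p (Z i j) \<le> real (card T) * ((1 / 2) ^ (2 ^ i) / (81 * real g ^ 12))"
      unfolding Z_def by (intro prob_ex_le[OF fT dep fJ]) auto
    then show ?thesis by (simp add: c_def)
  qed
  have W_sets: "W i \<in> events" for i unfolding W_def using Zs by auto
  have Wp: "prob (W i) \<le> c * (1 / 2) ^ (2 ^ i)" for i
  proof -
    have "incseq (\<lambda>j. {\<omega> \<in> space (perc_measure N p). Z i j \<omega>})"
      using very_bad_mono by (fastforce simp: incseq_def Z_def)
    then have "(\<lambda>j. prb N p (Z i j)) \<longlonglongrightarrow> prob (W i)"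
      unfolding W_def using Zs by (intro finite_Lim_measure_incseq) auto
    then show ?thesis using Zp by (intro LIMSEQ_le_const2) auto
  qed
  have "prob (\<Inter>i. W i) \<le> 0"
  proof (rule LIMSEQ_le_const)
    have "(\<lambda>i. (1 / 2 :: real) ^ (2 ^ i)) \<longlonglongrightarrow> 0"
      by (rule filterlim_compose[OF LIMSEQ_realpow_zero]) (auto intro!: filterlim_subseq simp: strict_mono_def)
    then show "(\<lambda>i. c * (1 / 2) ^ (2 ^ i)) \<longlonglongrightarrow> 0"
      using tendsto_mult_right_zero by blast
    have "prob (\<Inter>i. W i) \<le> c * (1 / 2) ^ (2 ^ i)" for i
      using finite_measure_mono[of "\<Inter>i. W i" "W i"] W_sets Wp[of i] by fastforce
    then show "\<exists>i0. \<forall>i\<ge>i0. prob (\<Inter>i. W i) \<le> c * (1 / 2) ^ (2 ^ i)" by blast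
  qed
  then have "prob (\<Inter>i. W i) = 0" using measure_nonneg[of "perc_measure N p" "\<Inter>i. W i"] by linarith
  then have "(\<Inter>i. W i) \<in> null_sets (perc_measure N p)"
    using W_sets by (auto simp: null_sets_def emeasure_eq_measure)
  then show "AE \<omega> in perc_measure N p. \<exists>i. \<forall>j. \<forall>a\<in>{0..int (M ^ n)}. \<forall>b\<in>{0..int (M ^ n)}.
    \<not> very_bad i j n a b \<omega>"
    by (rule AE_I') (auto simp: W_def Z_def T_def)
qed

end

section \<open>Images of curves and the choice of the scale\<close>

lemma curve_image_eq:
  assumes "\<Gamma> \<in> curves"
  obtains f where "f \<in> param_curves" "curve_image \<Gamma> = f ` {0..1}"
proof -
  obtain f where f: "f \<in> param_curves" "\<Gamma> = reparam_rel `` {f}"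
    using assms unfolding curves_def by (auto elim: quotientE)
  have "path_image h \<subseteq> path_image f" if "h \<in> \<Gamma>" for h
  proof -
    from that obtain \<phi> where "bij_betw \<phi> {0..1} {0..1}" "\<forall>t\<in>{0..1}. h t = f (\<phi> t)"
      by (auto simp: f reparam_rel_def)
    then show ?thesis by (auto simp: path_image_def bij_betw_def)
  qed
  moreover have "(f, f) \<in> reparam_rel"
    using f(1) unfolding reparam_rel_def
    by (auto intro!: exI[of _ "\<lambda>t. t"] simp: bij_betw_def strict_mono_on_def)
  then have "f \<in> \<Gamma>" by (simp add: f)
  ultimately have "curve_image \<Gamma> = f ` {0..1}"
    unfolding curve_image_def path_image_def[symmetric] by blast
  then show ?thesis using that f(1) by blast
qed

lemma eventually_scale_small:
  fixes \<theta> :: real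
  assumes "0 \<le> \<theta>" "\<theta> < 1"
  shows "\<forall>\<^sub>F g in sequentially. 324 * real g ^ 12 * (72 * real g ^ 3 * \<theta> ^ (g div 20)) \<le> 1"
proof -
  define q where "q = max \<theta> (1 / 2)"
  have q: "0 < q" "q < 1" "\<theta> \<le> q" using assms by (auto simp: q_def)
  \<comment> \<open>The fifteenth root reduces the decay of \<open>k^15 q^k\<close> to that of
    \<open>k x^k\<close>. The maximum with 1/2 keeps \<open>q\<close> positive for the division in
    \<open>K\<close>.\<close>
  define x where "x = root 15 q"
  have x: "0 < x" "x < 1" "x ^ 15 = q" using q by (auto simp: x_def)
  \<comment> \<open>\<open>23328 = 324 * 72\<close>; the power of 20 comes from
    \<open>g \<le> 20 * Suc k\<close>, and \<open>1 / q\<close> from passing from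
    \<open>q ^ k\<close> to \<open>q ^ Suc k\<close>.\<close>
  define K where "K = 23328 * 20 ^ 15 / q"
  have "(\<lambda>k. real k * x ^ k) \<longlonglongrightarrow> 0"
    using x by (intro powser_times_n_limit_0) auto
  then have "(\<lambda>k. K * (real (Suc k) * x ^ Suc k) ^ 15) \<longlonglongrightarrow> K * 0 ^ 15"
    by (intro tendsto_intros LIMSEQ_Suc)
  then have "\<forall>\<^sub>F k in sequentially. K * (real (Suc k) * x ^ Suc k) ^ 15 < 1"
    by (rule order_tendstoD) simp
  moreover have "filterlim (\<lambda>g::nat. g div 20) sequentially sequentially"
    unfolding filterlim_at_top eventually_sequentially by (metis div_le_mono nonzero_mult_div_cancel_right zero_neq_numeral)
  ultimately have "\<forall>\<^sub>F g in sequentially. K * (real (Suc (g div 20)) * x ^ Suc (g div 20)) ^ 15 < 1"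
    by (rule eventually_compose_filterlim)
  then show ?thesis
  proof eventually_elim
    case (elim g)
    define k where "k = g div 20"
    have "g < 20 * Suc k" unfolding k_def by simp
    then have "real g \<le> 20 * real (Suc k)" by linarith
    then have g: "real g ^ 15 \<le> (20 * real (Suc k)) ^ 15" by (intro power_mono) auto
    have "\<theta> ^ k \<le> q ^ k" using q assms by (intro power_mono) auto
    with g have "real g ^ 15 * \<theta> ^ k \<le> (20 * real (Suc k)) ^ 15 * q ^ k"
      using assms by (intro mult_mono) auto
    also have "q ^ k = (x ^ Suc k) ^ 15 / q"
    proof -
      have "(x ^ Suc k) ^ 15 = (x ^ 15) ^ Suc k" by (simp only: power_mult[symmetric] mult.commute)
      then show ?thesis using q(1) by (simp add: x(3))
    qed
    finally have "23328 * (real g ^ 15 * \<theta> ^ k) \<le> K * (real (Suc k) * x ^ Suc k) ^ 15"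
      by (simp only: K_def power_mult_distrib) simp
    moreover have "324 * real g ^ 12 * (72 * real g ^ 3 * \<theta> ^ k) = 23328 * (real g ^ 15 * \<theta> ^ k)"
      by (simp add: power_add[symmetric])
    ultimately show ?case using elim unfolding k_def by linarith
  qed
qed

theorem theorem1p6:
  fixes N :: nat and p :: real
  assumes "N \<ge> 2" and "crit_prob N \<le> p" and "p < 1"
  shows "\<exists>\<kappa>::real. \<kappa> > 1 \<and>
    (AE \<omega> in perc_measure N p. \<forall>\<Gamma> \<in> curves.
       nonconstant_curve \<Gamma> \<and> curve_image \<Gamma> \<subseteq> perc_connected N \<omega> \<longrightarrow>
       hausdorff_dim (curve_image \<Gamma>) \<ge> ennreal \<kappa>)"
proof -
  define x where "x = 1 - (1 - max 0 p) ^ 169"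
  have x: "0 \<le> x" "x < 1" using assms(3) by (auto simp: x_def power_le_one)
  have "filterlim (\<lambda>m. N ^ m) sequentially sequentially"
    using assms(1) by (intro filterlim_subseq) (auto simp: strict_mono_def)
  moreover have "\<forall>\<^sub>F g in sequentially. 2600 \<le> g \<and> 324 * real g ^ 12 * (72 * real g ^ 3 * x ^ (g div 20)) \<le> 1"
    using eventually_scale_small[OF x] eventually_ge_at_top[of 2600] by eventually_elim auto
  ultimately have "\<forall>\<^sub>F m in sequentially. 2600 \<le> N ^ m \<and>
      324 * real (N ^ m) ^ 12 * (72 * real (N ^ m) ^ 3 * x ^ (N ^ m div 20)) \<le> 1"
    by (rule eventually_compose_filterlim[rotated])
  \<comment> \<open>\<open>m\<close> depends only on \<open>N\<close> and \<open>p\<close>, so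
    \<open>\<kappa>\<close> is fixed before the configuration is drawn.\<close>
  then obtain m where m: "2600 \<le> N ^ m"
    "324 * real (N ^ m) ^ 12 * (72 * real (N ^ m) ^ 3 * x ^ (N ^ m div 20)) \<le> 1"
    using eventually_happens'[OF sequentially_bot] by blast
  interpret renormalization N m p
    using assms m(1) by unfold_locales
  have small: "324 * real g ^ 12 * \<rho> \<le> 1"
    using m(2) by (simp only: g_def \<rho>_def \<theta>_def x_def)
  have "AE \<omega> in perc_measure N p. \<forall>\<Gamma> \<in> curves.
       nonconstant_curve \<Gamma> \<and> curve_image \<Gamma> \<subseteq> perc_connected N \<omega> \<longrightarrow>
       hausdorff_dim (curve_image \<Gamma>) \<ge> ennreal \<kappa>"
    using AE_good[OF small]
  proof eventually_elim
    case (elim \<omega>)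
    show ?case
    proof (intro ballI impI)
      fix \<Gamma> assume "\<Gamma> \<in> curves" and \<Gamma>: "nonconstant_curve \<Gamma> \<and> curve_image \<Gamma> \<subseteq> perc_connected N \<omega>"
      from curve_image_eq[OF this(1)] obtain f where
        f: "f \<in> param_curves" "curve_image \<Gamma> = f ` {0..1}" .
      have "f ` {0..1} \<noteq> {f 0}" using \<Gamma> f(2) unfolding nonconstant_curve_def by blast
      moreover have "f 0 \<in> f ` {0..1}" by (intro imageI) simp
      ultimately obtain u where u: "u \<in> {0..1}" "f u \<noteq> f 0" by blast
      have "continuous_on {0..1} f" "f ` {0..1} \<subseteq> {0..1} \<times> {0..1}" "f ` {0..1} \<subseteq> perc_limit N \<omega>"
        using f \<Gamma> by (auto simp: param_curves_def path_def path_image_def perc_connected_def)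
      from path_dim[OF this(1,3,2) u(1) _ u(2)] elim show "hausdorff_dim (curve_image \<Gamma>) \<ge> ennreal \<kappa>"
        unfolding f(2) by simp
    qed
  qed
  then show ?thesis using \<kappa>_gt_1 by blast
qed

end
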